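(* Let $\mathcal{K}$ and $\mathcal{H}$ be two separable complex Hilbert spaces and let $\mu:T_1(\mathcal{K})\to T_1(\mathcal{H})$ be a bounded linear operator. Then $\mu$ is a quantum subchannel if and only if there exist bounded linear operators $A_i:\mathcal{K}\to\mathcal{H}$, $i\in\mathbb{N}$, such that $$\mu(a)=\sum_{i=1}^\infty A_i\,a\,A_i^\vee\quad\text{for all }a\in T_1(\mathcal{K}),\qquad \sum_{i=1}^\infty A_i^\vee A_i\le \mathrm{Id},$$ where the infinite sums converge in the weak operator topology.
   Context: $T_1(\mathcal{H})$ is the Banach space of trace class operators on $\mathcal{H}$ with the trace norm. For a bounded operator $A:\mathcal{K}\to\mathcal{H}$, $A^\vee:\mathcal{H}\to\mathcal{K}$ denotes its Hilbert space adjoint, $\langle A\mathbf{x},\mathbf{u}\rangle=\langle\mathbf{x},A^\vee\mathbf{u}\rangle$. $\mathrm{Id}$ is the identity on $\mathcal{K}$, and for selfadjoint operators $a\le b$ means that $b-a$ is positive (semidefinite). A series converges in the weak operator topology if for all vectors $\mathbf{x},\mathbf{y}$ the series of its matrix elements $\langle\cdot\,\mathbf{x},\mathbf{y}\rangle$ converges to that of the sum. An $n\times n$ matrix $G=[g_{ij}]$ of bounded operators on a Hilbert space is positive if $g_{ij}=g_{ji}^*$ for all $i,j$ and $\sum_{i,j=1}^n\langle g_{ij}\mathbf{x}_j,\mathbf{x}_i\rangle\ge0$ for all vectors $\mathbf{x}_1,\ldots,\mathbf{x}_n$ (inner product linear in the first argument). A bounded linear map $\mu:T_1(\mathcal{K})\to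 T_1(\mathcal{H})$ is completely positive if $\mu(g)^*=\mu(g^* )$ for all $g\in T_1(\mathcal{K})$ and, for each $n\in\mathbb{N}$ and each positive matrix $[g_{ij}]_{i,j=1}^n$ with entries in $T_1(\mathcal{K})$, the matrix $[\mu(g_{ij})]_{i,j=1}^n$ is positive. A quantum subchannel is a completely positive $\mu:T_1(\mathcal{K})\to T_1(\mathcal{H})$ such that $\operatorname{tr}\mu(g)\le\operatorname{tr}g$ for each density operator $g$ (i.e. $g\in T_1(\mathcal{K})$, $g\ge0$, $\operatorname{tr}g=1$); equivalently, for each positive $g\in T_1(\mathcal{K})$. *)

theory Defs
  imports "HOL-Analysis.Analysis" "HOL-Library.Complex_Order"
begin

section \<open>Complex Hilbert spaces\<close>

text \<open>
  HOL-Analysis only has real inner product spaces, so complex ones are introduced as type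
  classes on top of the real normed structure. The inner product is linear in the first
  argument and conjugate linear in the second. Here and below, \<open>\<le>\<close> on \<^typ>\<open>complex\<close> is the
  order of Complex_Order: \<open>z \<le> w\<close> iff \<open>Re z \<le> Re w\<close> and \<open>Im z = Im w\<close>; in particular
  \<open>0 \<le> z\<close> says that \<open>z\<close> is real and nonnegative.
\<close>

class complex_vector = real_vector +
  fixes scaleC :: "complex \<Rightarrow> 'a \<Rightarrow> 'a" (infixr "*\<^sub>C" 75)
  assumes scaleC_add_right: "c *\<^sub>C (x + y) = c *\<^sub>C x + c *\<^sub>C y"
    and scaleC_add_left: "(c + d) *\<^sub>C x = c *\<^sub>C x + d *\<^sub>C x"
    and scaleC_scaleC: "c *\<^sub>C d *\<^sub>C x = (c * d) *\<^sub>C x"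
    and scaleR_scaleC: "r *\<^sub>R x = complex_of_real r *\<^sub>C x"

class complex_inner = complex_vector + real_normed_vector +
  fixes cinner :: "'a \<Rightarrow> 'a \<Rightarrow> complex"
  assumes cinner_commute: "cinner x y = cnj (cinner y x)"
    and cinner_add_left: "cinner (x + y) z = cinner x z + cinner y z"
    and cinner_scaleC_left: "cinner (c *\<^sub>C x) y = c * cinner x y"
    and cinner_ge_zero: "0 \<le> cinner x x"
    and cinner_eq_zero_iff: "cinner x x = 0 \<longleftrightarrow> x = 0"
    and norm_eq_sqrt_cinner: "norm x = sqrt (Re (cinner x x))"

class complex_hilbert = complex_inner + complete_space

instantiation complex :: complex_hilbert
begin

definition scaleC_complex :: "complex \<Rightarrow> complex \<Rightarrow> complex"
  where "scaleC_complex c x = c * x"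

definition cinner_complex :: "complex \<Rightarrow> complex \<Rightarrow> complex"
  where "cinner_complex x y = x * cnj y"

instance
proof
  fix x y z c d :: complex and r :: real
  show "c *\<^sub>C (x + y) = c *\<^sub>C x + c *\<^sub>C y" "(c + d) *\<^sub>C x = c *\<^sub>C x + d *\<^sub>C x"
    "c *\<^sub>C d *\<^sub>C x = (c * d) *\<^sub>C x" "r *\<^sub>R x = complex_of_real r *\<^sub>C x"
    by (simp_all add: scaleC_complex_def algebra_simps scaleR_conv_of_real)
  show "cinner x y = cnj (cinner y x)" "cinner (x + y) z = cinner x z + cinner y z"
    "cinner (c *\<^sub>C x) y = c * cinner x y" "cinner x x = 0 \<longleftrightarrow> x = 0"
    by (simp_all add: scaleC_complex_def cinner_complex_def algebra_simps)
  show "0 \<le> cinner x x" "norm x = sqrt (Re (cinner x x))"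
    by (simp_all add: cinner_complex_def less_eq_complex_def cmod_def power2_eq_square)
qed

end

definition is_onb :: "'a::complex_inner set \<Rightarrow> bool" where
  "is_onb B \<longleftrightarrow> (\<forall>e\<in>B. \<forall>f\<in>B. cinner e f = (if e = f then 1 else 0)) \<and>
    (\<forall>x. (\<forall>e\<in>B. cinner x e = 0) \<longrightarrow> x = 0)"


section \<open>Bounded operators\<close>

definition bounded_clinear :: "('a::complex_inner \<Rightarrow> 'b::complex_inner) \<Rightarrow> bool" where
  "bounded_clinear A \<longleftrightarrow> bounded_linear A \<and> (\<forall>c x. A (c *\<^sub>C x) = c *\<^sub>C A x)"

definition adj :: "('a::complex_inner \<Rightarrow> 'b::complex_inner) \<Rightarrow> 'b \<Rightarrow> 'a" where
  "adj A = (THE B. \<forall>x u. cinner (A x) u = cinner x (B u))"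

definition selfadjoint :: "('a::complex_inner \<Rightarrow> 'a) \<Rightarrow> bool" where
  "selfadjoint A \<longleftrightarrow> bounded_clinear A \<and> adj A = A"

definition positive_op :: "('a::complex_inner \<Rightarrow> 'a) \<Rightarrow> bool" where
  "positive_op A \<longleftrightarrow> selfadjoint A \<and> (\<forall>x. 0 \<le> cinner (A x) x)"

definition op_le :: "('a::complex_inner \<Rightarrow> 'a) \<Rightarrow> ('a \<Rightarrow> 'a) \<Rightarrow> bool" where
  "op_le A B \<longleftrightarrow> selfadjoint A \<and> selfadjoint B \<and> positive_op (\<lambda>x. B x - A x)"

text \<open>\<open>wot_sums F S\<close>: the series \<open>F 0 + F 1 + \<dots>\<close> of operators converges to the bounded
  operator \<open>S\<close> in the weak operator topology.\<close>

definition wot_sums :: "(nat \<Rightarrow> 'a::complex_inner \<Rightarrow> 'b::complex_inner) \<Rightarrow> ('a \<Rightarrow> 'b) \<Rightarrow> bool" where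
  "wot_sums F S \<longleftrightarrow> bounded_clinear S \<and> (\<forall>x y. (\<lambda>i. cinner (F i x) y) sums cinner (S x) y)"


section \<open>Trace class operators\<close>

definition abs_op :: "('a::complex_hilbert \<Rightarrow> 'a) \<Rightarrow> 'a \<Rightarrow> 'a" where
  "abs_op A = (THE P. positive_op P \<and> P \<circ> P = adj A \<circ> A)"

definition trace_class :: "('a::complex_hilbert \<Rightarrow> 'a) \<Rightarrow> bool" where
  "trace_class A \<longleftrightarrow> bounded_clinear A \<and>
    (\<exists>B. is_onb B \<and> (\<lambda>e. cinner (abs_op A e) e) summable_on B)"

text \<open>On trace class operators the value does not depend on the orthonormal basis chosen.\<close>

definition trace :: "('a::complex_hilbert \<Rightarrow> 'a) \<Rightarrow> complex" where
  "trace A = (\<Sum>\<^sub>\<infinity>e\<in>(SOME B. is_onb B). cinner (A e) e)"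

definition trace_norm :: "('a::complex_hilbert \<Rightarrow> 'a) \<Rightarrow> real" where
  "trace_norm A = Re (trace (abs_op A))"

text \<open>Bounded linear maps between the Banach spaces of trace class operators. Such a map is
  represented by a function on all of \<^typ>\<open>'k \<Rightarrow> 'k\<close>, whose values outside the trace class
  are irrelevant.\<close>

definition trace_class_bounded_clinear ::
  "(('k::complex_hilbert \<Rightarrow> 'k) \<Rightarrow> ('h::complex_hilbert \<Rightarrow> 'h)) \<Rightarrow> bool" where
  "trace_class_bounded_clinear \<mu> \<longleftrightarrow>
    (\<forall>a. trace_class a \<longrightarrow> trace_class (\<mu> a)) \<and>
    (\<forall>a b. trace_class a \<longrightarrow> trace_class b \<longrightarrow> \<mu> (\<lambda>x. a x + b x) = (\<lambda>x. \<mu> a x + \<mu> b x)) \<and>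
    (\<forall>c a. trace_class a \<longrightarrow> \<mu> (\<lambda>x. c *\<^sub>C a x) = (\<lambda>x. c *\<^sub>C \<mu> a x)) \<and>
    (\<exists>C. \<forall>a. trace_class a \<longrightarrow> trace_norm (\<mu> a) \<le> C * trace_norm a)"


section \<open>Quantum subchannels\<close>

text \<open>Matrices are indexed by \<open>{..<n}\<close>.\<close>

definition positive_op_matrix :: "nat \<Rightarrow> (nat \<Rightarrow> nat \<Rightarrow> 'a::complex_inner \<Rightarrow> 'a) \<Rightarrow> bool" where
  "positive_op_matrix n g \<longleftrightarrow>
    (\<forall>i<n. \<forall>j<n. bounded_clinear (g i j)) \<and>
    (\<forall>i<n. \<forall>j<n. g i j = adj (g j i)) \<and>
    (\<forall>x. 0 \<le> (\<Sum>i<n. \<Sum>j<n. cinner (g i j (x j)) (x i)))"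

definition completely_positive ::
  "(('k::complex_hilbert \<Rightarrow> 'k) \<Rightarrow> ('h::complex_hilbert \<Rightarrow> 'h)) \<Rightarrow> bool" where
  "completely_positive \<mu> \<longleftrightarrow> trace_class_bounded_clinear \<mu> \<and>
    (\<forall>g. trace_class g \<longrightarrow> adj (\<mu> g) = \<mu> (adj g)) \<and>
    (\<forall>n g. (\<forall>i<n. \<forall>j<n. trace_class (g i j)) \<longrightarrow> positive_op_matrix n g \<longrightarrow>
      positive_op_matrix n (\<lambda>i j. \<mu> (g i j)))"

definition density_op :: "('a::complex_hilbert \<Rightarrow> 'a) \<Rightarrow> bool" where
  "density_op g \<longleftrightarrow> trace_class g \<and> positive_op g \<and> trace g = 1"

definition quantum_subchannel ::
  "(('k::complex_hilbert \<Rightarrow> 'k) \<Rightarrow> ('h::complex_hilbert \<Rightarrow> 'h)) \<Rightarrow> bool" where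
  "quantum_subchannel \<mu> \<longleftrightarrow> completely_positive \<mu> \<and>
    (\<forall>g. density_op g \<longrightarrow> trace (\<mu> g) \<le> trace g)"

end

theory Submission
  imports Defs
begin

text \<open>
  For a subchannel \<open>\<mu>\<close> the numbers \<open>\<langle>\<mu>(|u\<rangle>\<langle>v|) x, y\<rangle>\<close> form a positive kernel on pairs \<open>(u, y), (v, x)\<close>,
  by complete positivity. A Cholesky decomposition along a dense sequence of pairs writes it as
  \<open>\<Sum> L\<^sub>k(u, y) cnj (L\<^sub>k(v, x))\<close> with bounded sesquilinear \<open>L\<^sub>k\<close>, so \<open>L\<^sub>k(u, y) = \<langle>A\<^sub>k u, y\<rangle>\<close>. This is
  the Kraus formula for rank one operators, and \<open>\<Sum> \<parallel>A\<^sub>k u\<parallel>\<^sup>2 = tr \<mu>(|u\<rangle>\<langle>u|) \<le> \<parallel>u\<parallel>\<^sup>2\<close>. It extends to all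
  trace class operators because these are the sums \<open>\<Sum> |u\<^sub>i\<rangle>\<langle>v\<^sub>i|\<close> with \<open>\<Sum> \<parallel>u\<^sub>i\<parallel> \<parallel>v\<^sub>i\<parallel> < \<infinity>\<close>, by polar
  decomposition and square roots. The converse rests on \<open>\<Sum> \<parallel>T\<^sup>* f\<parallel>\<^sup>2 = \<Sum> \<parallel>T e\<parallel>\<^sup>2\<close> for orthonormal bases.
\<close>

section \<open>Complex inner products\<close>

text \<open>Elimination suits this kernel because Schur complements preserve both positivity and
  sesquilinearity: each column is already the matrix element of an operator, and the columns are
  numbered by \<open>nat\<close>. What elimination yields exactly is the formula for
  \<open>(v, x)\<close> in the chosen sequence and arbitrary \<open>(u, y)\<close>; this is where
  separability enters. The other pairs follow because, for fixed \<open>(u, y)\<close>, both sides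
  are bounded forms in \<open>(x, v)\<close>, and a bounded form that vanishes on a product of dense
  sets is zero. Boundedness of \<mu> makes the diagonal of the kernel at most
  \<open>C * (norm u)^2 * (norm y)^2\<close>, which bounds the factors and their square sums at
  once.

  The trace norm and the trace rest on a \<open>THE\<close> and a \<open>SOME\<close>, so uniqueness
  of square roots and independence of the basis come before any estimate. Trace norms are then
  bounded through nuclear series: a trace class operator minus a finite partial sum of its series is
  represented by the tail.

  The weak operator sums are ordered series, but sums over bases and over \<open>k\<close> have to
  be exchanged; hence unconditional \<open>has_sum\<close> is used until the last step.\<close>

lemma cinner_add_right: "cinner x (y + z) = cinner x y + cinner x z"
  by (metis cinner_add_left cinner_commute complex_cnj_add)

lemma cinner_scaleC_right: "cinner x (c *\<^sub>C y) = cnj c * cinner x y"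
  by (metis cinner_commute cinner_scaleC_left complex_cnj_mult)

lemma cinner_scaleR_left: "cinner (r *\<^sub>R x) y = r *\<^sub>R cinner x y"
  by (simp add: scaleR_scaleC[of r x] cinner_scaleC_left scaleR_conv_of_real)

lemma cinner_scaleR_right: "cinner x (r *\<^sub>R y) = r *\<^sub>R cinner x y"
  by (simp add: scaleR_scaleC[of r y] cinner_scaleC_right scaleR_conv_of_real)

lemma cinner_self: "cinner x x = complex_of_real ((norm x)\<^sup>2)"
  using cinner_ge_zero[of x] by (simp add: norm_eq_sqrt_cinner complex_eq_iff less_eq_complex_def)

text \<open>This serves as the Cauchy-Schwarz inequality for the inner product, for positive operators and
  for positive kernels.\<close>

lemma psd_2x2_det:
  fixes a c :: real and b :: complex
  assumes "\<And>s t. 0 \<le> (cmod s)\<^sup>2 * a + 2 * Re (s * cnj t * b) + (cmod t)\<^sup>2 * c"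
  shows "(cmod b)\<^sup>2 \<le> a * c"
proof -
  have a: "0 \<le> a" using assms[of 1 0] by simp
  have c: "0 \<le> c" using assms[of 0 1] by simp
  \<comment> \<open>The choice \<open>s = - r * cnj b\<close>, \<open>t = 1\<close> aligns the
    phases, so the mixed term becomes the real number \<open>- 2 * r * (cmod b)^2\<close>. For
    \<open>a > 0\<close> the minimiser \<open>r = 1/a\<close> gives the claim.\<close>
  have E: "0 \<le> (cmod b)\<^sup>2 * r\<^sup>2 * a - 2 * r * (cmod b)\<^sup>2 + c" for r :: real
  proof -
    have "- of_real r * cnj b * cnj 1 * b = complex_of_real (- r * (cmod b)\<^sup>2)"
      unfolding of_real_mult complex_norm_square by simp
    then have "Re (- of_real r * cnj b * cnj 1 * b) = - r * (cmod b)\<^sup>2"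
      by (simp only: Re_complex_of_real)
    with assms[of "- of_real r * cnj b" 1] show ?thesis
      by (simp only: norm_mult power_mult_distrib norm_minus_cancel norm_of_real complex_mod_cnj
          power2_abs norm_one) (simp add: algebra_simps)
  qed
  show ?thesis
  proof (cases "a = 0")
    case True
    show ?thesis
    proof (rule ccontr)
      assume "\<not> ?thesis"
      then have "(cmod b)\<^sup>2 > 0" using True by simp
      \<comment> \<open>For \<open>a = 0\<close> the bound is affine in \<open>r\<close> with
        negative slope; this \<open>r\<close> gives it the value \<open>-1\<close>.\<close>
      then show False using E[of "(c + 1) / (2 * (cmod b)\<^sup>2)"] True c by (simp add: field_simps)
    qed
  next
    case False
    then have "a > 0" using a by simp
    with E[of "1/a"] show ?thesis by (simp add: field_simps power2_eq_square)
  qed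
qed

lemma cinner_minus_left: "cinner (- x) y = - cinner x y"
  using cinner_scaleR_left[of "-1" x y] by simp

lemma cinner_minus_right: "cinner x (- y) = - cinner x y"
  using cinner_scaleR_right[of x "-1" y] by simp

lemma cinner_diff_left: "cinner (x - z) y = cinner x y - cinner z y"
  using cinner_add_left[of x "- z" y] by (simp add: cinner_minus_left)

lemma cinner_diff_right: "cinner y (x - z) = cinner y x - cinner y z"
  using cinner_add_right[of y x "- z"] by (simp add: cinner_minus_right)

lemma norm_add_square: "(norm (x + y))\<^sup>2 = (norm x)\<^sup>2 + 2 * Re (cinner x y) + (norm y)\<^sup>2"
proof -
  have "complex_of_real ((norm (x + y))\<^sup>2) = cinner x x + (cinner x y + cinner y x) + cinner y y"
    unfolding cinner_self[symmetric] by (simp add: cinner_add_left cinner_add_right)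
  also have "cinner x y + cinner y x = complex_of_real (2 * Re (cinner x y))"
    by (subst cinner_commute[of y x]) (rule complex_add_cnj)
  finally show ?thesis by (simp only: cinner_self of_real_add[symmetric] of_real_eq_iff)
qed

lemma norm_scaleC: "norm (c *\<^sub>C (x::'a::complex_inner)) = cmod c * norm x"
proof -
  have "complex_of_real ((norm (c *\<^sub>C x))\<^sup>2) = complex_of_real ((cmod c * norm x)\<^sup>2)"
    using cinner_self[of "c *\<^sub>C x"] cinner_self[of x] complex_norm_square[of c]
    by (simp add: cinner_scaleC_left cinner_scaleC_right power_mult_distrib mult_ac)
  then have "(norm (c *\<^sub>C x))\<^sup>2 = (cmod c * norm x)\<^sup>2" by (simp only: of_real_eq_iff)
  then show ?thesis by simp
qed

lemma cmod_cinner_le: "cmod (cinner x y) \<le> norm x * norm y"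
proof -
  have "(cmod (cinner x y))\<^sup>2 \<le> (norm x)\<^sup>2 * (norm y)\<^sup>2"
  proof (rule psd_2x2_det)
    fix s t
    have "0 \<le> (norm (s *\<^sub>C x + t *\<^sub>C y))\<^sup>2" by simp
    then show "0 \<le> (cmod s)\<^sup>2 * (norm x)\<^sup>2 + 2 * Re (s * cnj t * cinner x y) + (cmod t)\<^sup>2 * (norm y)\<^sup>2"
      by (simp add: norm_add_square norm_scaleC power_mult_distrib cinner_scaleC_left
          cinner_scaleC_right algebra_simps del: times_complex.sel)
  qed
  then show ?thesis
    by (metis norm_ge_zero power2_le_imp_le power_mult_distrib zero_le_mult_iff)
qed

interpretation cinner: bounded_bilinear "cinner :: 'a::complex_inner \<Rightarrow> 'a \<Rightarrow> complex"
proof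
  show "\<exists>K. \<forall>a b :: 'a. cmod (cinner a b) \<le> norm a * norm b * K"
    by (rule exI[of _ 1]) (simp add: cmod_cinner_le)
qed (simp_all add: cinner_add_left cinner_add_right cinner_scaleR_left cinner_scaleR_right)

lemma cinner_ext: "(\<And>y. cinner x y = cinner z y) \<Longrightarrow> x = z"
  by (metis cinner_diff_left cinner_eq_zero_iff eq_iff_diff_eq_0)

lemma cinner_ext_right: "(\<And>y. cinner y x = cinner y z) \<Longrightarrow> x = z"
  by (metis cinner_diff_right cinner_eq_zero_iff eq_iff_diff_eq_0)

lemma scaleC_zero_right [simp]: "c *\<^sub>C (0::'a::complex_inner) = 0"
  by (rule cinner_ext) (simp add: cinner_scaleC_left cinner.zero_left)

lemma scaleC_zero_left [simp]: "0 *\<^sub>C (x::'a::complex_inner) = 0"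
  by (rule cinner_ext) (simp add: cinner_scaleC_left cinner.zero_left)

lemma scaleC_minus_one: "(-1) *\<^sub>C (x::'a::complex_inner) = - x"
  by (rule cinner_ext) (simp add: cinner_scaleC_left cinner_minus_left)

lemma norm_le_of_cinner:
  assumes "0 \<le> C" "\<And>y. cmod (cinner x y) \<le> C * norm y"
  shows "norm x \<le> C"
proof (cases "x = 0")
  case False
  have "norm x * norm x \<le> C * norm x"
    using assms(2)[of x] by (simp add: cinner_self norm_mult power2_eq_square)
  then show ?thesis using False by simp
qed (use assms in simp)

section \<open>Riesz representation\<close>

lemma bounded_clinearD:
  assumes "bounded_clinear A"
  shows "bounded_linear A" "A (x + y) = A x + A y" "A (c *\<^sub>C x) = c *\<^sub>C A x" "A 0 = 0"
    "A (x - y) = A x - A y" "A (r *\<^sub>R x) = r *\<^sub>R A x" "A (- x) = - A x"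
  using assms
  by (auto simp: bounded_clinear_def linear_simps bounded_linear.linear)

lemma bounded_clinear_bound:
  assumes "bounded_clinear A"
  obtains C where "C \<ge> 0" "\<And>x. norm (A x) \<le> C * norm x"
  using bounded_linear.nonneg_bounded[of A] assms
  unfolding bounded_clinear_def by (metis mult.commute)

lemma bounded_clinearI:
  assumes "\<And>x y. A (x + y) = A x + A y" "\<And>c x. A (c *\<^sub>C x) = c *\<^sub>C A x"
    "\<And>x. norm (A x) \<le> C * norm x"
  shows "bounded_clinear A"
  unfolding bounded_clinear_def using assms
  by (auto intro!: bounded_linear_intro[where K=C] simp: scaleR_scaleC mult.commute)

lemma bounded_clinear_compose:
  "bounded_clinear A \<Longrightarrow> bounded_clinear B \<Longrightarrow> bounded_clinear (\<lambda>x. A (B x))"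
  unfolding bounded_clinear_def by (auto intro: bounded_linear_compose)

lemma bounded_clinear_add:
  "bounded_clinear A \<Longrightarrow> bounded_clinear B \<Longrightarrow> bounded_clinear (\<lambda>x. A x + B x)"
  unfolding bounded_clinear_def by (auto intro: bounded_linear_add simp: scaleC_add_right)

lemma bounded_clinear_scaleC:
  "bounded_clinear A \<Longrightarrow> bounded_clinear (\<lambda>x. c *\<^sub>C A x)"
proof -
  assume A: "bounded_clinear A"
  then obtain C where C: "\<And>x. norm (A x) \<le> C * norm x" by (rule bounded_clinear_bound) blast
  show ?thesis
  proof (rule bounded_clinearI)
    show "norm (c *\<^sub>C A x) \<le> cmod c * C * norm x" for x
      using mult_left_mono[OF C, of "cmod c" x] by (simp add: norm_scaleC mult.assoc)
  qed (simp_all add: bounded_clinearD[OF A] scaleC_add_right scaleC_scaleC mult.commute)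
qed

lemma bounded_clinear_minus: "bounded_clinear A \<Longrightarrow> bounded_clinear (\<lambda>x. - A x)"
  using bounded_clinear_scaleC[of A "-1"] by (simp add: scaleC_minus_one)

lemma bounded_clinear_diff:
  "bounded_clinear A \<Longrightarrow> bounded_clinear B \<Longrightarrow> bounded_clinear (\<lambda>x. A x - B x)"
  using bounded_clinear_add[OF _ bounded_clinear_minus, of A B] by simp

lemma bounded_clinear_id: "bounded_clinear (\<lambda>x. x)"
  unfolding bounded_clinear_def by (simp add: bounded_linear_ident)

lemma bounded_clinear_zero: "bounded_clinear (\<lambda>x. 0)"
  unfolding bounded_clinear_def by (simp add: bounded_linear_zero)

lemma bounded_clinear_sum:
  "(\<And>i. i \<in> I \<Longrightarrow> bounded_clinear (A i)) \<Longrightarrow> bounded_clinear (\<lambda>x. \<Sum>i\<in>I. A i x)"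
  by (induction I rule: infinite_finite_induct)
    (auto intro: bounded_clinear_add bounded_clinear_zero)

instance complex_hilbert \<subseteq> banach ..

text \<open>The representing vector is a limit of \<open>Q x\<^sub>n\<close> along a minimising sequence of
  \<open>\<parallel>Q x\<parallel>\<^sup>2 - 2 Re (\<phi> x)\<close>. The last conclusion (\<open>z\<close> lies in the closed range of \<open>Q\<close>) makes
  it unique.\<close>

lemma riesz_range:
  fixes Q :: "'a::complex_inner \<Rightarrow> 'b::complex_hilbert" and \<phi> :: "'a \<Rightarrow> complex"
  assumes Q: "\<And>x y. Q (x + y) = Q x + Q y" "\<And>c x. Q (c *\<^sub>C x) = c *\<^sub>C Q x"
    and \<phi>: "\<And>x y. \<phi> (x + y) = \<phi> x + \<phi> y" "\<And>c x. \<phi> (c *\<^sub>C x) = c * \<phi> x"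
    and bd: "\<And>x. cmod (\<phi> x) \<le> C * norm (Q x)" and C: "C \<ge> 0"
  shows "\<exists>z. (\<forall>x. \<phi> x = cinner (Q x) z) \<and> norm z \<le> C \<and>
    (\<forall>w. (\<forall>x. cinner (Q x) w = 0) \<longrightarrow> cinner z w = 0)"
proof -
  have \<phi>r: "\<phi> (r *\<^sub>R x) = r *\<^sub>R \<phi> x" for r x
    by (simp add: scaleR_scaleC[of r x] \<phi> scaleR_conv_of_real)
  have Qr: "Q (r *\<^sub>R x) = r *\<^sub>R Q x" for r x by (simp add: scaleR_scaleC Q)
  \<comment> \<open>If \<open>\<phi> x = cinner (Q x) z\<close>, then
    \<open>J x = (norm (Q x - z))^2 - (norm z)^2\<close>; minimising \<open>J\<close> drives
    \<open>Q x\<close> towards the vector sought.\<close>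
  define J where "J x = (norm (Q x))\<^sup>2 - 2 * Re (\<phi> x)" for x
  have Jlow: "- C\<^sup>2 \<le> J x" for x
  proof -
    have "Re (\<phi> x) \<le> C * norm (Q x)" using bd[of x] complex_Re_le_cmod[of "\<phi> x"] by linarith
    moreover have "0 \<le> (norm (Q x) - C)\<^sup>2" by simp
    ultimately show ?thesis unfolding J_def by (simp add: power2_diff algebra_simps)
  qed
  define m where "m = Inf (range J)"
  have bdd: "bdd_below (range J)" using Jlow by (auto intro!: bdd_belowI)
  have mle: "m \<le> J x" for x unfolding m_def by (rule cInf_lower[OF _ bdd]) simp
  have "\<exists>x. J x < m + 1 / real (Suc n)" for n
  proof -
    have "m < m + 1 / real (Suc n)" by simp
    then show ?thesis unfolding m_def using cInf_lessD[of "range J"] by blast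
  qed
  then obtain X where X: "\<And>n. J (X n) < m + 1 / real (Suc n)" by metis
  have "(\<lambda>n. m + 1 / real (Suc n)) \<longlonglongrightarrow> m + 0"
    by (intro tendsto_add tendsto_const) (use LIMSEQ_inverse_real_of_nat in \<open>simp add: inverse_eq_divide\<close>)
  then have Jlim: "(\<lambda>n. J (X n)) \<longlonglongrightarrow> m"
    by (intro tendsto_sandwich[of "\<lambda>_. m" "\<lambda>n. J (X n)" _ "\<lambda>n. m + 1 / real (Suc n)" m])
      (auto simp: mle intro!: eventuallyI less_imp_le[OF X] simp del: of_nat_Suc)
  \<comment> \<open>Parallelogram identity: the left side equals \<open>2 * J x + 2 * J y\<close>
    minus four times \<open>J\<close> at the midpoint, and \<open>J\<close> is at least
    \<open>m\<close> there. Hence a minimising sequence is Cauchy.\<close>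
  have par: "(norm (Q x - Q y))\<^sup>2 \<le> 2 * (J x - m) + 2 * (J y - m)" for x y
  proof -
    have "4 * J ((1/2) *\<^sub>R (x + y)) = (norm (Q x + Q y))\<^sup>2 - 4 * Re (\<phi> x) - 4 * Re (\<phi> y)"
      unfolding J_def by (simp add: Qr \<phi>r Q \<phi> power_divide algebra_simps flip: scaleR_add_right)
    moreover have "(norm (Q x - Q y))\<^sup>2 = (norm (Q x))\<^sup>2 - 2 * Re (cinner (Q x) (Q y)) + (norm (Q y))\<^sup>2"
      using norm_add_square[of "Q x" "- Q y"] by (simp add: cinner_minus_right)
    ultimately show ?thesis using mle[of "(1/2) *\<^sub>R (x + y)"] norm_add_square[of "Q x" "Q y"]
      unfolding J_def by simp
  qed
  have "Cauchy (\<lambda>n. Q (X n))"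
  proof (rule CauchyI)
    fix e :: real assume e: "e > 0"
    then have "e\<^sup>2 / 4 > 0" by simp
    then have "\<forall>\<^sub>F n in sequentially. J (X n) < m + e\<^sup>2 / 4"
      by (intro order_tendstoD(2)[OF Jlim]) simp
    then obtain M where M: "\<And>n. n \<ge> M \<Longrightarrow> J (X n) < m + e\<^sup>2 / 4"
      by (auto simp: eventually_sequentially)
    have "norm (Q (X k) - Q (X n)) < e" if "k \<ge> M" "n \<ge> M" for k n
    proof -
      have "2 * (J (X k) - m) + 2 * (J (X n) - m) < 2 * (e\<^sup>2 / 4) + 2 * (e\<^sup>2 / 4)"
        using M[OF that(1)] M[OF that(2)] by (intro add_strict_mono mult_strict_left_mono) simp_all
      then have "(norm (Q (X k) - Q (X n)))\<^sup>2 < e\<^sup>2" using par[of "X k" "X n"] by simp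
      then show ?thesis using e by (simp add: power_less_imp_less_base)
    qed
    then show "\<exists>M. \<forall>k\<ge>M. \<forall>n\<ge>M. norm (Q (X k) - Q (X n)) < e" by blast
  qed
  then obtain z where z: "(\<lambda>n. Q (X n)) \<longlonglongrightarrow> z" by (auto simp: Cauchy_convergent_iff convergent_def)
  \<comment> \<open>The first variation of \<open>J\<close> at the minimum, in the direction
    \<open>h\<close>, is \<open>2 * D\<close> and must vanish. Applying this to
    \<open>\<i> *\<^sub>C h\<close> as well recovers the imaginary part.\<close>
  have zRe: "Re (\<phi> h) = Re (cinner (Q h) z)" for h
  proof -
    define D where "D = Re (cinner z (Q h)) - Re (\<phi> h)"
    have pos: "0 \<le> 2 * t * D + t\<^sup>2 * (norm (Q h))\<^sup>2" for t
    proof -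
      have eq: "J (X n + t *\<^sub>R h) = J (X n) + 2 * t * (Re (cinner (Q (X n)) (Q h)) - Re (\<phi> h)) + t\<^sup>2 * (norm (Q h))\<^sup>2" for n
        unfolding J_def by (simp add: Q Qr \<phi> \<phi>r norm_add_square cinner_scaleR_right power_mult_distrib algebra_simps)
      have "(\<lambda>n. J (X n + t *\<^sub>R h)) \<longlonglongrightarrow> m + 2 * t * D + t\<^sup>2 * (norm (Q h))\<^sup>2"
        unfolding eq D_def by (intro tendsto_intros Jlim cinner.tendsto z)
      then have "m \<le> m + 2 * t * D + t\<^sup>2 * (norm (Q h))\<^sup>2"
        by (rule LIMSEQ_le_const) (use mle in blast)
      then show ?thesis by simp
    qed
    have "D = 0"
    proof (rule ccontr)
      assume D: "D \<noteq> 0"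
      \<comment> \<open>The step \<open>t = - D / N\<close> is nearly the minimiser of the quadratic
        in \<open>t\<close>; the added \<open>1\<close> keeps \<open>N\<close> positive when
        \<open>Q h = 0\<close>.\<close>
      define N where "N = (norm (Q h))\<^sup>2 + 1"
      have N: "N > 0" unfolding N_def by (simp add: add_nonneg_pos)
      have "2 * (- (D / N)) * D + (- (D / N))\<^sup>2 * (norm (Q h))\<^sup>2 = - (D / N)\<^sup>2 * (N + 1)"
      proof -
        have "(norm (Q h))\<^sup>2 = N - 1" by (simp add: N_def)
        then show ?thesis using N
          by (simp only: power_divide power2_minus) (simp add: divide_simps power2_eq_square, simp add: algebra_simps)
      qed
      also have "\<dots> < 0" using N D by (simp add: mult_neg_pos)
      finally show False using pos[of "- (D / N)"] by linarith
    qed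
    moreover have "Re (cinner z (Q h)) = Re (cinner (Q h) z)" by (metis cinner_commute cnj.sel(1))
    ultimately show ?thesis by (simp add: D_def)
  qed
  have zin: "\<phi> h = cinner (Q h) z" for h
    using zRe[of h] zRe[of "\<i> *\<^sub>C h"] by (simp add: \<phi> Q cinner_scaleC_left complex_eq_iff)
  have "norm z \<le> C"
  proof -
    have "norm (cinner z z) \<le> C * norm z"
    proof (rule LIMSEQ_le)
      show "(\<lambda>n. norm (cinner (Q (X n)) z)) \<longlonglongrightarrow> norm (cinner z z)" by (intro tendsto_intros cinner.tendsto z)
      show "(\<lambda>n. C * norm (Q (X n))) \<longlonglongrightarrow> C * norm z" by (intro tendsto_intros z)
      show "\<exists>N. \<forall>n\<ge>N. cmod (cinner (Q (X n)) z) \<le> C * norm (Q (X n))"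
        using bd by (simp add: zin)
    qed
    then have "norm z * norm z \<le> C * norm z" by (simp add: cinner_self norm_mult power2_eq_square)
    then show ?thesis using C by (cases "norm z = 0") (simp_all add: mult_le_cancel_right)
  qed
  moreover have "cinner z w = 0" if "\<forall>x. cinner (Q x) w = 0" for w
  proof -
    have "(\<lambda>n. cinner (Q (X n)) w) \<longlonglongrightarrow> cinner z w" by (intro cinner.tendsto z tendsto_const)
    then show ?thesis using that by (simp add: LIMSEQ_const_iff)
  qed
  ultimately show ?thesis using zin by blast
qed

lemma riesz:
  fixes \<phi> :: "'a::complex_hilbert \<Rightarrow> complex"
  assumes "\<And>x y. \<phi> (x + y) = \<phi> x + \<phi> y" "\<And>c x. \<phi> (c *\<^sub>C x) = c * \<phi> x"
    and "\<And>x. cmod (\<phi> x) \<le> C * norm x" "C \<ge> 0"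
  shows "\<exists>z. (\<forall>x. \<phi> x = cinner x z) \<and> norm z \<le> C"
  using riesz_range[of "\<lambda>x. x" \<phi> C] assms by auto

text \<open>For fixed \<open>x\<close> the functional \<open>y \<mapsto> cnj (s x y)\<close> is
  linear and bounded, so Riesz supplies \<open>A x\<close>. Adjoints, the operator in Parseval's
  identity, the Kraus operators and the sum of the \<open>adj (A k) \<circ> A k\<close> are all
  obtained from their forms in this way.\<close>

lemma bounded_form_represented:
  fixes s :: "'a::complex_inner \<Rightarrow> 'b::complex_hilbert \<Rightarrow> complex"
  assumes "\<And>x x' y. s (x + x') y = s x y + s x' y" "\<And>c x y. s (c *\<^sub>C x) y = c * s x y"
    and "\<And>x y y'. s x (y + y') = s x y + s x y'" "\<And>c x y. s x (c *\<^sub>C y) = cnj c * s x y"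
    and bd: "\<And>x y. cmod (s x y) \<le> C * norm x * norm y" and "C \<ge> 0"
  obtains A where "bounded_clinear A" "\<And>x y. cinner (A x) y = s x y" "\<And>x. norm (A x) \<le> C * norm x"
proof -
  have "\<exists>z. (\<forall>y. cnj (s x y) = cinner y z) \<and> norm z \<le> C * norm x" for x
    by (rule riesz) (use assms in auto)
  then obtain A where A: "\<And>x y. cnj (s x y) = cinner y (A x)" "\<And>x. norm (A x) \<le> C * norm x"
    by metis
  have A': "cinner (A x) y = s x y" for x y by (metis A(1) cinner_commute complex_cnj_cnj)
  have "bounded_clinear A"
    by (rule bounded_clinearI[OF _ _ A(2)]; rule cinner_ext)
      (simp_all add: A' assms cinner_add_left cinner_scaleC_left)
  then show thesis using A A' that by blast
qed

section \<open>Adjoints and Douglas factorization\<close>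

lemma adj_eqI:
  assumes "\<And>x u. cinner (A x) u = cinner x (B u)"
  shows "adj A = B"
  unfolding adj_def
proof (rule the_equality)
  fix B' assume "\<forall>x u. cinner (A x) u = cinner x (B' u)"
  then show "B' = B" using assms by (metis cinner_ext_right ext)
qed (use assms in auto)

lemma
  fixes A :: "'a::complex_hilbert \<Rightarrow> 'b::complex_inner"
  assumes A: "bounded_clinear A"
  shows cinner_adj: "cinner (A x) u = cinner x (adj A u)"
    and bounded_clinear_adj: "bounded_clinear (adj A)"
proof -
  obtain C where C: "C \<ge> 0" "\<And>x. norm (A x) \<le> C * norm x" using bounded_clinear_bound[OF A] by blast
  have bd: "cmod (cinner u (A x)) \<le> C * norm u * norm x" for x u
    using order.trans[OF cmod_cinner_le mult_left_mono[OF C(2)[of x] norm_ge_zero[of u]]]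
    by (simp add: mult_ac)
  obtain B where B: "bounded_clinear B" "\<And>u x. cinner (B u) x = cinner u (A x)"
    by (rule bounded_form_represented[of "\<lambda>u x. cinner u (A x)", OF _ _ _ _ bd C(1)])
      (auto simp: bounded_clinearD[OF A] cinner_add_left cinner_add_right cinner_scaleC_left cinner_scaleC_right)
  have "adj A = B" by (rule adj_eqI) (metis B(2) cinner_commute)
  then show "cinner (A x) u = cinner x (adj A u)" "bounded_clinear (adj A)"
    using B cinner_commute by metis+
qed

lemma cinner_adj': 
  fixes A :: "'a::complex_hilbert \<Rightarrow> 'b::complex_inner"
  assumes A: "bounded_clinear A"
  shows "cinner (adj A u) x = cinner u (A x)"
  by (metis cinner_adj[OF A] cinner_commute)

lemma norm_adj_le:
  fixes A :: "'a::complex_hilbert \<Rightarrow> 'b::complex_inner"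
  assumes A: "bounded_clinear A" and C: "\<And>x. norm (A x) \<le> C * norm x" "C \<ge> 0"
  shows "norm (adj A u) \<le> C * norm u"
proof (rule norm_le_of_cinner)
  fix y
  show "cmod (cinner (adj A u) y) \<le> C * norm u * norm y"
    unfolding cinner_adj'[OF A]
    using order.trans[OF cmod_cinner_le mult_left_mono[OF C(1)[of y] norm_ge_zero[of u]]]
    by (simp add: mult_ac)
qed (use C in simp)

text \<open>\<open>W\<close> is prescribed on the range of \<open>b\<close>; its adjoint
  \<open>T\<close> can be found one vector at a time, since
  \<open>x \<mapsto> cinner (a x) y\<close> is dominated by \<open>norm y * norm (b x)\<close>. Both
  forms of the polar decomposition, \<open>a = U |a|\<close> and \<open>|a| = W a\<close> with
  contractions, are instances.\<close>

lemma douglas_factorization: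
  fixes a :: "'a::complex_inner \<Rightarrow> 'b::complex_hilbert" and b :: "'a \<Rightarrow> 'c::complex_hilbert"
  assumes a: "bounded_clinear a" and b: "bounded_clinear b"
    and le: "\<And>x. norm (a x) \<le> norm (b x)"
  obtains W where "bounded_clinear W" "\<And>y. norm (W y) \<le> norm y" "\<And>x. a x = W (b x)"
proof -
  have bd: "cmod (cinner (a x) y) \<le> norm y * norm (b x)" for x y
    using order.trans[OF cmod_cinner_le mult_right_mono[OF le[of x] norm_ge_zero[of y]]]
    by (simp add: mult_ac)
  have "\<exists>z. (\<forall>x. cinner (a x) y = cinner (b x) z) \<and> norm z \<le> norm y \<and>
    (\<forall>w. (\<forall>x. cinner (b x) w = 0) \<longrightarrow> cinner z w = 0)" for y
    by (rule riesz_range[OF _ _ _ _ bd])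
      (auto simp: bounded_clinearD[OF a] bounded_clinearD[OF b] cinner_add_left cinner_scaleC_left)
  then obtain T where T: "\<And>x y. cinner (a x) y = cinner (b x) (T y)" "\<And>y. norm (T y) \<le> norm y"
    "\<And>y w. (\<And>x. cinner (b x) w = 0) \<Longrightarrow> cinner (T y) w = 0" by metis
  \<comment> \<open>The defects of additivity and homogeneity of \<open>T\<close> are orthogonal to
    the range of \<open>b\<close> and also, like every value of \<open>T\<close>, orthogonal to its
    orthogonal complement. So they are orthogonal to themselves.\<close>
  have T0: "t = 0" if "\<And>w. (\<And>x. cinner (b x) w = 0) \<Longrightarrow> cinner t w = 0"
    "\<And>x. cinner (b x) t = 0" for t
    using that cinner_eq_zero_iff by blast
  have "T (y + y') - (T y + T y') = 0" for y y'
    by (rule T0) (simp_all add: cinner_diff_left cinner_diff_right cinner_add_left cinner_add_right T(3) flip: T(1))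
  moreover have "T (c *\<^sub>C y) - c *\<^sub>C T y = 0" for c y
    by (rule T0) (simp_all add: cinner_diff_left cinner_diff_right cinner_scaleC_left cinner_scaleC_right T(3) flip: T(1))
  ultimately have bT: "bounded_clinear T" by (intro bounded_clinearI[where C=1]) (auto simp: T(2))
  show thesis
  proof
    show "bounded_clinear (adj T)" by (rule bounded_clinear_adj[OF bT])
    show "norm (adj T y) \<le> norm y" for y using norm_adj_le[OF bT, of 1 y] T(2) by simp
    show "a x = adj T (b x)" for x by (rule cinner_ext) (simp add: T(1) cinner_adj'[OF bT])
  qed
qed

section \<open>Orthonormal bases\<close>

definition orthonormal :: "'a::complex_inner set \<Rightarrow> bool" where
  "orthonormal S \<longleftrightarrow> (\<forall>e\<in>S. \<forall>f\<in>S. cinner e f = (if e = f then 1 else 0))"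

lemma orthonormal_subset: "orthonormal S \<Longrightarrow> T \<subseteq> S \<Longrightarrow> orthonormal T"
  unfolding orthonormal_def by blast

lemma orthonormal_onb: "is_onb B \<Longrightarrow> orthonormal B"
  unfolding is_onb_def orthonormal_def by blast

text \<open>By Zorn there is a maximal orthonormal set. A nonzero vector orthogonal to it could be
  normalised and added.\<close>

lemma onb_exists: "\<exists>B :: 'a::complex_inner set. is_onb B"
proof -
  have "\<exists>M\<in>Collect orthonormal. \<forall>X\<in>Collect orthonormal. M \<subseteq> X \<longrightarrow> X = (M :: 'a set)"
  proof (rule subset_Zorn)
    fix C :: "'a set set" assume C: "subset.chain (Collect orthonormal) C"
    have "orthonormal (\<Union>C)"
      unfolding orthonormal_def
    proof (intro ballI)
      fix e f assume "e \<in> \<Union>C" "f \<in> \<Union>C"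
      then obtain X Y where "X \<in> C" "Y \<in> C" "e \<in> X" "f \<in> Y" by blast
      moreover from this have "X \<subseteq> Y \<or> Y \<subseteq> X" using C unfolding subset_chain_def by blast
      ultimately obtain Z where "Z \<in> C" "e \<in> Z" "f \<in> Z" by blast
      moreover then have "orthonormal Z" using C unfolding subset_chain_def by blast
      ultimately show "cinner e f = (if e = f then 1 else 0)" unfolding orthonormal_def by blast
    qed
    then show "\<exists>U\<in>Collect orthonormal. \<forall>X\<in>C. X \<subseteq> U" by blast
  qed
  then obtain M :: "'a set" where M: "orthonormal M" "\<And>X. orthonormal X \<Longrightarrow> M \<subseteq> X \<Longrightarrow> X = M" by blast
  have "x = 0" if x: "\<forall>e\<in>M. cinner x e = 0" for x
  proof (rule ccontr)
    assume x0: "x \<noteq> 0"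
    define u where "u = complex_of_real (1 / norm x) *\<^sub>C x"
    have "norm u = 1" using x0 by (simp add: u_def norm_scaleC norm_divide)
    then have u: "cinner u u = 1" "\<And>e. e \<in> M \<Longrightarrow> cinner u e = 0 \<and> cinner e u = 0"
      using x cinner_commute[of _ x]
      by (auto simp: cinner_self) (auto simp: u_def cinner_scaleC_left cinner_scaleC_right)
    then have "orthonormal (insert u M)" using M(1) unfolding orthonormal_def by auto
    then have "u \<in> M" using M(2)[of "insert u M"] by blast
    then show False using u by force
  qed
  then show ?thesis using M(1) unfolding is_onb_def orthonormal_def by blast
qed

lemma bessel:
  assumes F: "finite F" "orthonormal F"
  shows "(\<Sum>e\<in>F. (cmod (cinner x e))\<^sup>2) \<le> (norm x)\<^sup>2"
proof -
  define y where "y = (\<Sum>e\<in>F. cinner x e *\<^sub>C e)"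
  define s where "s = (\<Sum>e\<in>F. (cmod (cinner x e))\<^sup>2)"
  have ey: "cinner y e = cinner x e" if "e \<in> F" for e
  proof -
    have "cinner y e = (\<Sum>f\<in>F. cinner x f * (if f = e then 1 else 0))"
      unfolding y_def cinner.sum_left
      using F that unfolding orthonormal_def by (auto intro!: sum.cong simp: cinner_scaleC_left)
    also have "\<dots> = cinner x e" using F that by (simp add: if_distrib cong: if_cong)
    finally show ?thesis .
  qed
  \<comment> \<open>\<open>x\<close> and its projection \<open>y\<close> have the same coefficients
    on \<open>F\<close>, so this applies with \<open>z = y\<close> and \<open>z = x\<close>.
    Expanding \<open>(norm (x - y))^2\<close> then gives \<open>(norm x)^2 - s\<close>.\<close>
  have *: "cinner z y = complex_of_real s" if "\<And>e. e \<in> F \<Longrightarrow> cinner z e = cinner x e" for z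
    unfolding y_def s_def cinner.sum_right of_real_sum
    by (rule sum.cong) (simp_all add: cinner_scaleC_right that complex_norm_square mult.commute flip: of_real_power)
  have "cinner y y = complex_of_real s" "cinner x y = complex_of_real s"
    by (rule *, simp add: ey)+
  then have "(norm y)\<^sup>2 = s" "Re (cinner x (- y)) = - s"
    by (simp_all add: cinner_self cinner_minus_right flip: of_real_power)
  moreover have "0 \<le> (norm (x + - y))\<^sup>2" by simp
  ultimately show ?thesis unfolding norm_add_square s_def[symmetric] by simp
qed

text \<open>Cauchy-Schwarz with square sums bounded over finite subsets, which is the form in which
  Bessel's inequality and the Cholesky bound deliver them; summability comes out as part of the
  conclusion.\<close>

lemma l2_product:
  fixes f g :: "'i \<Rightarrow> real"
  assumes "0 \<le> a" "0 \<le> b"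
    and f: "\<And>F. finite F \<Longrightarrow> F \<subseteq> I \<Longrightarrow> (\<Sum>i\<in>F. (f i)\<^sup>2) \<le> a\<^sup>2"
    and g: "\<And>F. finite F \<Longrightarrow> F \<subseteq> I \<Longrightarrow> (\<Sum>i\<in>F. (g i)\<^sup>2) \<le> b\<^sup>2"
  shows "(\<lambda>i. \<bar>f i\<bar> * \<bar>g i\<bar>) summable_on I" "infsum (\<lambda>i. \<bar>f i\<bar> * \<bar>g i\<bar>) I \<le> a * b"
proof -
  have *: "(\<Sum>i\<in>F. \<bar>f i\<bar> * \<bar>g i\<bar>) \<le> a * b" if "finite F" "F \<subseteq> I" for F
  proof -
    have "(\<Sum>i\<in>F. \<bar>f i\<bar> * \<bar>g i\<bar>) \<le> L2_set f F * L2_set g F" by (rule L2_set_mult_ineq)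
    also have "\<dots> \<le> a * b"
      using f[OF that] g[OF that] assms(1,2) unfolding L2_set_def
      by (intro mult_mono) (auto simp: real_le_lsqrt sum_nonneg)
    finally show ?thesis .
  qed
  show "(\<lambda>i. \<bar>f i\<bar> * \<bar>g i\<bar>) summable_on I"
    by (rule nonneg_bdd_above_summable_on) (auto intro!: bdd_aboveI[of _ "a * b"] *)
  then show "infsum (\<lambda>i. \<bar>f i\<bar> * \<bar>g i\<bar>) I \<le> a * b"
    by (rule infsum_le_finite_sums) (rule *)
qed

lemma l2_product_complex:
  fixes f g :: "'i \<Rightarrow> complex"
  assumes "0 \<le> a" "0 \<le> b"
    and "\<And>F. finite F \<Longrightarrow> F \<subseteq> I \<Longrightarrow> (\<Sum>i\<in>F. (cmod (f i))\<^sup>2) \<le> a\<^sup>2"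
    and "\<And>F. finite F \<Longrightarrow> F \<subseteq> I \<Longrightarrow> (\<Sum>i\<in>F. (cmod (g i))\<^sup>2) \<le> b\<^sup>2"
  shows "(\<lambda>i. f i * g i) summable_on I" "cmod (infsum (\<lambda>i. f i * g i) I) \<le> a * b"
proof -
  note * = l2_product[of a b I "\<lambda>i. cmod (f i)" "\<lambda>i. cmod (g i)", OF assms, simplified]
  have s: "(\<lambda>i. cmod (f i * g i)) summable_on I" and i: "infsum (\<lambda>i. cmod (f i * g i)) I \<le> a * b"
    using * by (simp_all add: norm_mult)
  show "(\<lambda>i. f i * g i) summable_on I" by (rule abs_summable_summable[OF s])
  show "cmod (infsum (\<lambda>i. f i * g i) I) \<le> a * b"
    using norm_infsum_bound[OF s] i by linarith
qed

text \<open>The form \<open>\<Sum> \<langle>x, e\<rangle> \<langle>e, y\<rangle>\<close> is bounded by Bessel's inequality, hence represented by some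
  \<open>P\<close>, and \<open>P x - x\<close> is orthogonal to the basis. This avoids vector-valued series.\<close>

lemma parseval:
  fixes x y :: "'a::complex_hilbert"
  assumes B: "is_onb B"
  shows "((\<lambda>e. cinner x e * cinner e y) has_sum cinner x y) B"
proof -
  have on: "orthonormal F" if "F \<subseteq> B" for F using orthonormal_subset orthonormal_onb B that by blast
  define s where "s x y = infsum (\<lambda>e. cinner x e * cinner e y) B" for x y :: 'a
  have bes: "(\<Sum>e\<in>F. (cmod (cinner x e))\<^sup>2) \<le> (norm x)\<^sup>2" "(\<Sum>e\<in>F. (cmod (cinner e x))\<^sup>2) \<le> (norm x)\<^sup>2"
    if "finite F" "F \<subseteq> B" for x F
    using bessel[OF that(1) on[OF that(2)], of x] cinner_commute[of x] by simp_all
  have sm: "(\<lambda>e. cinner x e * cinner e y) summable_on B" for x y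
    by (rule l2_product_complex[of "norm x" "norm y"]) (use bes in auto)
  have sb: "cmod (s x y) \<le> 1 * norm x * norm y" for x y
    unfolding s_def using l2_product_complex(2)[of "norm x" "norm y" B "cinner x" "\<lambda>e. cinner e y"] bes by simp
  obtain P where P: "bounded_clinear P" "\<And>x y. cinner (P x) y = s x y"
  proof (rule bounded_form_represented[of s 1])
    show "s (x + x') y = s x y + s x' y" for x x' y
      unfolding s_def by (simp add: cinner_add_left distrib_right infsum_add sm)
    show "s (c *\<^sub>C x) y = c * s x y" for c x y
      unfolding s_def by (simp add: cinner_scaleC_left mult.assoc infsum_cmult_right')
    show "s x (y + y') = s x y + s x y'" for x y y'
      unfolding s_def by (simp add: cinner_add_right distrib_left infsum_add sm)
    show "s x (c *\<^sub>C y) = cnj c * s x y" for c x y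
      unfolding s_def by (simp add: cinner_scaleC_right mult.left_commute infsum_cmult_right')
  qed (use sb in auto)
  have "P x - x = 0"
  proof -
    have "cinner (P x - x) f = 0" if f: "f \<in> B" for f
    proof -
      have "s x f = infsum (\<lambda>e. cinner x e * cinner e f) {f}"
        unfolding s_def using B f unfolding is_onb_def by (intro infsum_cong_neutral) auto
      also have "\<dots> = cinner x f" using B f unfolding is_onb_def by simp
      finally show ?thesis by (simp add: cinner_diff_left P)
    qed
    then show ?thesis using B unfolding is_onb_def by blast
  qed
  then have "cinner x y = s x y" using P(2)[of x y] by simp
  then show ?thesis unfolding s_def using sm by simp
qed

lemma parseval_norm:
  fixes x :: "'a::complex_hilbert"
  assumes B: "is_onb B"
  shows "((\<lambda>e. (cmod (cinner x e))\<^sup>2) has_sum (norm x)\<^sup>2) B"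
proof -
  have "cinner x e * cinner e x = complex_of_real ((cmod (cinner x e))\<^sup>2)" for e
    by (subst (2) cinner_commute) (simp only: complex_norm_square)
  then show ?thesis using parseval[OF B, of x x] by (simp only: cinner_self has_sum_of_real_iff)
qed

lemma has_sum_sum:
  fixes f :: "'i \<Rightarrow> 'j \<Rightarrow> 'a::topological_comm_monoid_add"
  shows "(\<And>j. j \<in> J \<Longrightarrow> ((\<lambda>i. f i j) has_sum s j) I) \<Longrightarrow> ((\<lambda>i. \<Sum>j\<in>J. f i j) has_sum (\<Sum>j\<in>J. s j)) I"
  by (induction J rule: infinite_finite_induct) (auto intro: has_sum_add)

text \<open>Both sides come from the numbers \<open>(cmod (cinner (T e) f))^2\<close>: Parseval in
  \<open>B\<close> sums them over \<open>e\<close> for each \<open>f\<close>, Bessel in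
  \<open>F\<close> over \<open>f\<close> for each \<open>e\<close>. With \<open>F\<close> finite,
  the exchange of sums is immediate. This half of the Hilbert-Schmidt identity yields basis
  independence of the trace and the trace estimate for Kraus maps.\<close>

lemma sum_norm_adj_square_le:
  fixes T :: "'a::complex_hilbert \<Rightarrow> 'b::complex_inner"
  assumes T: "bounded_clinear T" and B: "is_onb B" and F: "finite F" "orthonormal F"
    and s: "(\<lambda>e. (norm (T e))\<^sup>2) summable_on B"
  shows "(\<Sum>f\<in>F. (norm (adj T f))\<^sup>2) \<le> infsum (\<lambda>e. (norm (T e))\<^sup>2) B"
proof -
  have "((\<lambda>e. \<Sum>f\<in>F. (cmod (cinner (T e) f))\<^sup>2) has_sum (\<Sum>f\<in>F. (norm (adj T f))\<^sup>2)) B"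
  proof (rule has_sum_sum)
    fix f
    show "((\<lambda>e. (cmod (cinner (T e) f))\<^sup>2) has_sum (norm (adj T f))\<^sup>2) B"
      using parseval_norm[OF B, of "adj T f"] cinner_commute[of f] by (simp add: cinner_adj'[OF T])
  qed
  then show ?thesis
    by (rule has_sum_mono[OF _ has_sum_infsum[OF s]]) (rule bessel[OF F])
qed

section \<open>Square roots and absolute values\<close>

lemma positive_opI:
  fixes A :: "'a::complex_inner \<Rightarrow> 'a"
  assumes "bounded_clinear A" "\<And>x y. cinner (A x) y = cinner x (A y)" "\<And>x. 0 \<le> Re (cinner (A x) x)"
  shows "positive_op A"
proof -
  have "Im (cinner (A x) x) = 0" for x
    using cinner_commute[of "A x" x] by (simp add: assms(2) complex_eq_iff)
  then show ?thesis
    using assms by (auto simp: positive_op_def selfadjoint_def less_eq_complex_def intro: adj_eqI)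
qed

lemma positive_opD:
  fixes A :: "'a::complex_hilbert \<Rightarrow> 'a"
  assumes "positive_op A"
  shows "bounded_clinear A" "cinner (A x) y = cinner x (A y)" "0 \<le> Re (cinner (A x) x)"
    "adj A = A" "0 \<le> cinner (A x) x"
  using assms cinner_adj[of A x y] by (auto simp: positive_op_def selfadjoint_def less_eq_complex_def)

lemma positive_op_cauchy_schwarz:
  fixes P :: "'a::complex_hilbert \<Rightarrow> 'a"
  assumes P: "positive_op P"
  shows "(cmod (cinner (P x) y))\<^sup>2 \<le> Re (cinner (P x) x) * Re (cinner (P y) y)"
proof (rule psd_2x2_det)
  fix s t
  have "cinner (P (s *\<^sub>C x + t *\<^sub>C y)) (s *\<^sub>C x + t *\<^sub>C y) =
    complex_of_real ((cmod s)\<^sup>2) * cinner (P x) x + complex_of_real (2 * Re (s * cnj t * cinner (P x) y))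
    + complex_of_real ((cmod t)\<^sup>2) * cinner (P y) y"
    unfolding complex_norm_square complex_add_cnj[symmetric]
    using cinner_commute[of "P x" y] positive_opD(2)[OF P, of y x]
    by (simp add: bounded_clinearD[OF positive_opD(1)[OF P]] cinner_add_left cinner_add_right
        cinner_scaleC_left cinner_scaleC_right algebra_simps)
  also have "Re \<dots> = (cmod s)\<^sup>2 * Re (cinner (P x) x) + 2 * Re (s * cnj t * cinner (P x) y)
    + (cmod t)\<^sup>2 * Re (cinner (P y) y)"
    by simp
  finally show "0 \<le> (cmod s)\<^sup>2 * Re (cinner (P x) x) + 2 * Re (s * cnj t * cinner (P x) y)
    + (cmod t)\<^sup>2 * Re (cinner (P y) y)"
    using positive_opD(3)[OF P, of "s *\<^sub>C x + t *\<^sub>C y"] by simp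
qed

lemma positive_op_eq_zero:
  fixes P :: "'a::complex_hilbert \<Rightarrow> 'a"
  assumes P: "positive_op P" and "cinner (P x) x = 0"
  shows "P x = 0"
  using positive_op_cauchy_schwarz[OF P, of x "P x"] assms(2)
  by (simp add: cinner_eq_zero_iff)

section \<open>Square roots of positive operators by iteration\<close>

fun sqrt_majorant :: "nat \<Rightarrow> real" where
  "sqrt_majorant 0 = 0"
| "sqrt_majorant (Suc n) = (1 + (sqrt_majorant n)\<^sup>2) / 2"

text \<open>The iterates converge to \<open>1 - sqrt (1 - B)\<close> for \<open>\<parallel>B\<parallel> \<le> 1\<close>. The distance of two iterates is
  bounded by that of the corresponding iterates for the number \<open>B = 1\<close>, which increase to \<open>1\<close>.\<close>

fun sqrt_iter :: "('a::real_normed_vector \<Rightarrow>\<^sub>L 'a) \<Rightarrow> nat \<Rightarrow> ('a \<Rightarrow>\<^sub>L 'a)" where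
  "sqrt_iter B 0 = 0"
| "sqrt_iter B (Suc n) = (1/2) *\<^sub>R (B + (sqrt_iter B n o\<^sub>L sqrt_iter B n))"

lemma sqrt_majorant_bounds: "0 \<le> sqrt_majorant n" "sqrt_majorant n \<le> 1"
proof -
  have "0 \<le> sqrt_majorant n \<and> sqrt_majorant n \<le> 1"
    by (induction n) (auto simp: power_le_one)
  then show "0 \<le> sqrt_majorant n" "sqrt_majorant n \<le> 1" by auto
qed

lemma sqrt_majorant_incseq: "incseq sqrt_majorant"
proof (rule incseq_SucI)
  fix n
  have "0 \<le> (1 - sqrt_majorant n)\<^sup>2" by simp
  then show "sqrt_majorant n \<le> sqrt_majorant (Suc n)" by (simp add: power2_diff)
qed

lemma norm_sqrt_iter_le: "norm B \<le> 1 \<Longrightarrow> norm (sqrt_iter B n) \<le> sqrt_majorant n"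
proof (induction n)
  case (Suc n)
  let ?Y = "sqrt_iter B n"
  have "norm (?Y o\<^sub>L ?Y) \<le> (sqrt_majorant n)\<^sup>2"
    using norm_blinfun_compose[of ?Y ?Y] mult_mono[OF Suc.IH Suc.IH] Suc.prems sqrt_majorant_bounds(1)[of n]
    by (simp add: power2_eq_square)
  then show ?case using norm_triangle_ineq[of B "?Y o\<^sub>L ?Y"] Suc.prems by simp
qed simp

lemma norm_sqrt_iter_Suc_diff:
  assumes B: "norm B \<le> 1"
  shows "norm (sqrt_iter B (Suc n) - sqrt_iter B n) \<le> sqrt_majorant (Suc n) - sqrt_majorant n"
proof (induction n)
  case 0
  then show ?case using B by simp
next
  case (Suc n)
  let ?Y = "sqrt_iter B n" and ?Z = "sqrt_iter B (Suc n)"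
  let ?y = "sqrt_majorant n" and ?z = "sqrt_majorant (Suc n)"
  have "sqrt_iter B (Suc (Suc n)) - ?Z =
    (1/2) *\<^sub>R (B + (?Z o\<^sub>L ?Z)) - (1/2) *\<^sub>R (B + (?Y o\<^sub>L ?Y))"
    by (simp only: sqrt_iter.simps)
  also have "\<dots> = (1/2) *\<^sub>R ((?Z o\<^sub>L ?Z) - (?Y o\<^sub>L ?Y))"
    by (simp only: scaleR_diff_right[symmetric]) simp
  \<comment> \<open>This factorization needs no commutation, and its two norms add up to the scalar
    \<open>(z - y) * (z + y) = z^2 - y^2\<close>.\<close>
  also have "(?Z o\<^sub>L ?Z) - (?Y o\<^sub>L ?Y) = (?Z o\<^sub>L (?Z - ?Y)) + ((?Z - ?Y) o\<^sub>L ?Y)"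
    by (rule blinfun_eqI) (simp add: blinfun.diff_left blinfun.add_left blinfun.diff_right del: sqrt_iter.simps)
  finally have "norm (sqrt_iter B (Suc (Suc n)) - ?Z) \<le>
    (1/2) * (norm (?Z o\<^sub>L (?Z - ?Y)) + norm ((?Z - ?Y) o\<^sub>L ?Y))"
    using norm_triangle_ineq[of "?Z o\<^sub>L (?Z - ?Y)" "(?Z - ?Y) o\<^sub>L ?Y"] by simp
  also have "\<dots> \<le> (1/2) * (?z * (?z - ?y) + (?z - ?y) * ?y)"
    using sqrt_majorant_bounds norm_sqrt_iter_le[OF B] Suc.IH incseq_SucD[OF sqrt_majorant_incseq, of n]
    by (intro mult_left_mono add_mono order.trans[OF norm_blinfun_compose] mult_mono) (auto simp del: sqrt_iter.simps sqrt_majorant.simps)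
  also have "\<dots> = sqrt_majorant (Suc (Suc n)) - ?z"
  proof -
    have "sqrt_majorant (Suc (Suc n)) - ?z = (1 + ?z\<^sup>2) / 2 - (1 + ?y\<^sup>2) / 2"
      by (simp only: sqrt_majorant.simps)
    then show ?thesis by (simp add: field_simps power2_eq_square del: sqrt_majorant.simps)
  qed
  finally show ?case .
qed

lemma sqrt_iter_convergent:
  fixes B :: "'a::banach \<Rightarrow>\<^sub>L 'a"
  assumes B: "norm B \<le> 1"
  obtains Y where "sqrt_iter B \<longlonglongrightarrow> Y" "Y = (1/2) *\<^sub>R (B + (Y o\<^sub>L Y))" "norm Y \<le> 1"
proof -
  \<comment> \<open>The increments of a bounded increasing real sequence are summable and dominate
    the operator increments, so the iterates converge in norm.\<close>
  have "summable (\<lambda>n. sqrt_majorant (Suc n) - sqrt_majorant n)"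
  proof (rule telescope_summable)
    show "sqrt_majorant \<longlonglongrightarrow> lim sqrt_majorant"
      using incseq_convergent[OF sqrt_majorant_incseq, of 1] sqrt_majorant_bounds(2)
      by (metis limI)
  qed
  then have "summable (\<lambda>n. sqrt_iter B (Suc n) - sqrt_iter B n)"
    by (rule summable_comparison_test'[of _ 0]) (rule norm_sqrt_iter_Suc_diff[OF B])
  then have "convergent (\<lambda>n. sqrt_iter B n - sqrt_iter B 0)"
    by (simp add: summable_iff_convergent sum_lessThan_telescope del: sqrt_iter.simps)
  then obtain Y where Y: "sqrt_iter B \<longlonglongrightarrow> Y" by (auto simp: convergent_def)
  have "(\<lambda>n. sqrt_iter B (Suc n)) \<longlonglongrightarrow> (1/2) *\<^sub>R (B + (Y o\<^sub>L Y))"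
    unfolding sqrt_iter.simps
    by (intro tendsto_intros bounded_bilinear.tendsto[OF bounded_bilinear_blinfun_compose] Y)
  then have "Y = (1/2) *\<^sub>R (B + (Y o\<^sub>L Y))" using LIMSEQ_unique LIMSEQ_Suc[OF Y] by blast
  moreover have "norm Y \<le> 1"
    by (rule LIMSEQ_le_const2[OF tendsto_norm[OF Y]])
      (use norm_sqrt_iter_le[OF B] sqrt_majorant_bounds(2) order.trans in blast)
  ultimately show thesis using Y that by blast
qed

lemma blinfun_tendsto_apply: "Y \<longlonglongrightarrow> L \<Longrightarrow> (\<lambda>n. blinfun_apply (Y n) x) \<longlonglongrightarrow> blinfun_apply L x"
  by (intro tendsto_intros)

text \<open>The iterates are real polynomials in \<open>B\<close>. The map \<open>P\<close> need
  only be real linear, so that multiplication by a complex scalar is admissible.\<close>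

lemma sqrt_iter_commute:
  assumes "linear P" "\<And>x. P (blinfun_apply B x) = blinfun_apply B (P x)"
  shows "P (blinfun_apply (sqrt_iter B n) x) = blinfun_apply (sqrt_iter B n) (P x)"
  using assms by (induction n arbitrary: x)
    (auto simp: linear_0 linear_add linear_scale blinfun.add_left blinfun.scaleR_left)

lemma sqrt_iter_symmetric:
  fixes B :: "'a::complex_inner \<Rightarrow>\<^sub>L 'a"
  assumes "\<And>x y. cinner (blinfun_apply B x) y = cinner x (blinfun_apply B y)"
  shows "cinner (blinfun_apply (sqrt_iter B n) x) y = cinner x (blinfun_apply (sqrt_iter B n) y)"
  using assms by (induction n arbitrary: x y)
    (auto simp: cinner.zero_left cinner.zero_right cinner_add_left cinner_add_right cinner_scaleR_left
        cinner_scaleR_right blinfun.add_left blinfun.scaleR_left)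

text \<open>Scaling reduces to \<open>b = 1 - A / C\<close> with \<open>0 \<le> b \<le> 1\<close>;
  the limit \<open>Y\<close> stands for \<open>1 - sqrt (1 - b)\<close>, and
  \<open>Q = sqrt C * (1 - Y)\<close> is positive because \<open>norm Y \<le> 1\<close>. The
  commutation property, inherited from the polynomials in \<open>b\<close>, is what the uniqueness
  proof relies on.\<close>

lemma positive_sqrt_exists:
  fixes A :: "'a::complex_hilbert \<Rightarrow> 'a"
  assumes A: "positive_op A"
  obtains Q where "positive_op Q" "\<And>x. Q (Q x) = A x"
    "\<And>P x. bounded_clinear P \<Longrightarrow> (\<And>x. P (A x) = A (P x)) \<Longrightarrow> P (Q x) = Q (P x)"
proof -
  obtain C0 where C0: "C0 \<ge> 0" "\<And>x. norm (A x) \<le> C0 * norm x"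
    using bounded_clinear_bound[OF positive_opD(1)[OF A]] by blast
  \<comment> \<open>The added \<open>1\<close> keeps the divisor \<open>C\<close> positive even for
    \<open>A = 0\<close>.\<close>
  define C where "C = C0 + 1"
  have C: "C > 0" "norm (A x) \<le> C * norm x" for x
    using C0(1) C0(2)[of x] norm_ge_zero[of x] unfolding C_def distrib_right by linarith+
  define b where "b x = x - (1/C) *\<^sub>R A x" for x
  have bsym: "cinner (b x) y = cinner x (b y)" for x y
    unfolding b_def by (simp add: cinner_diff_left cinner_diff_right cinner_scaleR_left cinner_scaleR_right positive_opD(2)[OF A])
  have bC: "bounded_clinear b"
    unfolding b_def
    using bounded_clinear_diff[OF bounded_clinear_id bounded_clinear_scaleC[OF positive_opD(1)[OF A], of "of_real (1/C)"]]
    by (simp only: scaleR_scaleC)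
  have bq: "Re (cinner (b x) x) = (norm x)\<^sup>2 - Re (cinner (A x) x) / C" for x
    unfolding b_def by (simp add: cinner_diff_left cinner_scaleR_left cinner_self flip: of_real_power)
  have Aq: "Re (cinner (A x) x) \<le> C * (norm x)\<^sup>2" for x
  proof -
    have "Re (cinner (A x) x) \<le> norm (A x) * norm x"
      using complex_Re_le_cmod cmod_cinner_le order.trans by blast
    also have "\<dots> \<le> C * norm x * norm x" by (intro mult_right_mono C) simp
    finally show ?thesis by (simp add: power2_eq_square mult.assoc)
  qed
  have bpos: "positive_op b"
    by (rule positive_opI[OF bC bsym]) (use Aq C in \<open>simp add: bq field_simps\<close>)
  have ble: "Re (cinner (b x) x) \<le> (norm x)\<^sup>2" for x
    unfolding bq using positive_opD(3)[OF A, of x] C by simp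
  \<comment> \<open>Cauchy-Schwarz for the positive form of \<open>b\<close> turns the bound on its
    diagonal into a bound on its norm.\<close>
  have bn: "norm (b x) \<le> norm x" for x
  proof (rule norm_le_of_cinner)
    fix y
    have "(cmod (cinner (b x) y))\<^sup>2 \<le> (norm x)\<^sup>2 * (norm y)\<^sup>2"
      using positive_op_cauchy_schwarz[OF bpos, of x y]
        mult_mono[OF ble[of x] ble[of y]] positive_opD(3)[OF bpos, of y] by simp
    then show "cmod (cinner (b x) y) \<le> norm x * norm y"
      by (metis norm_ge_zero power2_le_imp_le power_mult_distrib zero_le_mult_iff)
  qed simp
  define B where "B = Blinfun b"
  have Bb: "blinfun_apply B = b"
    unfolding B_def using bounded_clinearD(1)[OF bC] by (rule bounded_linear_Blinfun_apply)
  have "norm B \<le> 1" by (rule norm_blinfun_bound) (simp_all add: Bb bn)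
  then obtain Y where Y: "sqrt_iter B \<longlonglongrightarrow> Y" "Y = (1/2) *\<^sub>R (B + (Y o\<^sub>L Y))" "norm Y \<le> 1"
    by (rule sqrt_iter_convergent)
  \<comment> \<open>The fixed point equation of the iteration, equivalent to
    \<open>(1 - Y)^2 = 1 - b\<close>.\<close>
  have Yeq: "b x = 2 *\<^sub>R Y x - Y (Y x)" for x
  proof -
    have "Y x = (1/2) *\<^sub>R (b x + Y (Y x))"
      using arg_cong[OF Y(2), of "\<lambda>T. blinfun_apply T x"] by (simp add: Bb blinfun.add_left blinfun.scaleR_left)
    then have "2 *\<^sub>R Y x = 2 *\<^sub>R ((1/2) *\<^sub>R (b x + Y (Y x)))" by (rule arg_cong)
    then show ?thesis by simp
  qed
  have Ycomm: "P (Y x) = Y (P x)" if P: "bounded_linear P" "\<And>x. P (b x) = b (P x)" for P x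
  proof -
    have "P (sqrt_iter B n x) = sqrt_iter B n (P x)" for n
      by (rule sqrt_iter_commute) (use P in \<open>auto simp: Bb bounded_linear.linear\<close>)
    moreover have "(\<lambda>n. P (sqrt_iter B n x)) \<longlonglongrightarrow> P (Y x)"
      by (intro bounded_linear.tendsto[OF P(1)] blinfun_tendsto_apply Y)
    ultimately show ?thesis using LIMSEQ_unique[OF _ blinfun_tendsto_apply[OF Y(1), of "P x"]] by simp
  qed
  have Ysym: "cinner (Y x) y = cinner x (Y y)" for x y
  proof -
    have "cinner (sqrt_iter B n x) y = cinner x (sqrt_iter B n y)" for n
      by (rule sqrt_iter_symmetric) (simp add: Bb bsym)
    moreover have "(\<lambda>n. cinner (sqrt_iter B n x) y) \<longlonglongrightarrow> cinner (Y x) y"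
      "(\<lambda>n. cinner x (sqrt_iter B n y)) \<longlonglongrightarrow> cinner x (Y y)"
      by (intro cinner.tendsto blinfun_tendsto_apply Y tendsto_const)+
    ultimately show ?thesis using LIMSEQ_unique by simp
  qed
  \<comment> \<open>The iteration lives among real linear maps. Complex linearity of
    \<open>Y\<close> is its commutation with \<open>x \<mapsto> c *\<^sub>C x\<close>, which holds
    because \<open>b\<close> commutes with that map.\<close>
  have YC: "bounded_clinear Y"
    unfolding bounded_clinear_def
  proof (intro conjI allI)
    show "bounded_linear (blinfun_apply Y)" by (rule blinfun.bounded_linear_right)
    fix c x
    have "bounded_linear (\<lambda>x::'a. c *\<^sub>C x)"
      using bounded_clinearD(1)[OF bounded_clinear_scaleC[OF bounded_clinear_id]] .
    then show "Y (c *\<^sub>C x) = c *\<^sub>C Y x"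
      using Ycomm[of "\<lambda>x. c *\<^sub>C x" x] by (simp add: bounded_clinearD[OF bC])
  qed
  define Q where "Q x = sqrt C *\<^sub>R (x - Y x)" for x
  have QC: "bounded_clinear Q"
    unfolding Q_def scaleR_scaleC
    by (intro bounded_clinear_scaleC bounded_clinear_diff bounded_clinear_id YC)
  show thesis
  proof
    show "positive_op Q"
    proof (rule positive_opI[OF QC])
      show "cinner (Q x) y = cinner x (Q y)" for x y
        unfolding Q_def by (simp add: cinner_scaleR_left cinner_scaleR_right cinner_diff_left cinner_diff_right Ysym)
      fix x
      have "norm (Y x) \<le> norm x" using norm_blinfun[of Y x] mult_right_mono[OF Y(3) norm_ge_zero[of x]] by simp
      then have "Re (cinner (Y x) x) \<le> norm x * norm x"
        using complex_Re_le_cmod[of "cinner (Y x) x"] cmod_cinner_le[of "Y x" x]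
          mult_right_mono[OF _ norm_ge_zero[of x]] by fastforce
      then show "0 \<le> Re (cinner (Q x) x)"
        unfolding Q_def using C(1)
        by (simp add: cinner_scaleR_left cinner_diff_left cinner_self power2_eq_square)
    qed
    fix x
    have "Q (Q x) = (sqrt C * sqrt C) *\<^sub>R (x - (2 *\<^sub>R Y x - Y (Y x)))"
      unfolding Q_def by (simp add: blinfun.diff_right blinfun.scaleR_right algebra_simps scaleR_2)
    also have "\<dots> = A x" using C(1) unfolding Yeq[symmetric] b_def by simp
    finally show "Q (Q x) = A x" .
  next
    fix P :: "'a \<Rightarrow> 'a" and x assume P: "bounded_clinear P" "\<And>x. P (A x) = A (P x)"
    then have "P (Y x) = Y (P x)"
      by (intro Ycomm) (auto simp: bounded_clinearD b_def)
    then show "P (Q x) = Q (P x)" unfolding Q_def by (simp add: bounded_clinearD[OF P(1)])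
  qed
qed

lemma positive_sqrt_unique:
  fixes P :: "'a::complex_hilbert \<Rightarrow> 'a"
  assumes P: "positive_op P" and Q: "positive_op Q"
    and PQ: "\<And>x. P (P x) = Q (Q x)"
  shows "P = Q"
proof -
  text \<open>It suffices to compare with the square root that commutes with the commutant of \<open>P\<^sup>2\<close>.\<close>
  define A where "A x = P (P x)" for x
  have A: "positive_op A"
  proof (rule positive_opI)
    show "bounded_clinear A"
      unfolding A_def by (rule bounded_clinear_compose) (rule positive_opD(1)[OF P])+
  qed (simp_all add: A_def positive_opD(2)[OF P] cinner_self)
  obtain R where R: "positive_op R" "\<And>x. R (R x) = A x"
    "\<And>P x. bounded_clinear P \<Longrightarrow> (\<And>x. P (A x) = A (P x)) \<Longrightarrow> P (R x) = R (P x)"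
    using positive_sqrt_exists[OF A] by blast
  have "P = R" if P: "positive_op P" and PA: "\<And>x. P (P x) = A x" for P
  proof
    fix x
    note Pl = bounded_clinearD[OF positive_opD(1)[OF P]]
    note Rl = bounded_clinearD[OF positive_opD(1)[OF R(1)]]
    have comm: "P (R x) = R (P x)" for x
      by (rule R(3)) (use P PA positive_opD(1) in \<open>auto simp flip: PA\<close>)
    \<comment> \<open>Since \<open>P\<close> and \<open>R\<close> commute,
      \<open>(P + R) (P - R) x = P (P x) - R (R x) = 0\<close>. Thus two nonnegative numbers
      \<open>cinner (P y) y\<close> and \<open>cinner (R y) y\<close> add up to zero, so
      \<open>P y = R y = 0\<close>, and symmetry of \<open>P - R\<close> gives
      \<open>cinner y y = 0\<close>.\<close>
    define y where "y = P x - R x"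
    have "P y + R y = 0" unfolding y_def by (simp add: Pl Rl comm PA R(2))
    then have "cinner (P y) y + cinner (R y) y = 0" by (simp add: cinner.zero_left flip: cinner_add_left)
    then have "cinner (P y) y = 0" "cinner (R y) y = 0"
      using positive_opD(5)[OF P, of y] positive_opD(5)[OF R(1), of y]
      by (auto simp: complex_eq_iff less_eq_complex_def)
    then have "P y = 0" "R y = 0" using positive_op_eq_zero P R(1) by auto
    then have "cinner (P x - R x) y = 0"
      by (simp add: cinner_diff_left positive_opD(2)[OF P] positive_opD(2)[OF R(1)] cinner.zero_right)
    then have "y = 0" by (simp only: y_def[symmetric] cinner_eq_zero_iff)
    then show "P x = R x" by (simp add: y_def)
  qed
  then show ?thesis using P Q PQ A_def by metis
qed

section \<open>Absolute values\<close>

lemma positive_op_adj_comp: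
  fixes A :: "'a::complex_hilbert \<Rightarrow> 'b::complex_hilbert"
  assumes A: "bounded_clinear A"
  shows "positive_op (\<lambda>x. adj A (A x))"
proof (rule positive_opI)
  show "bounded_clinear (\<lambda>x. adj A (A x))" by (rule bounded_clinear_compose[OF bounded_clinear_adj[OF A] A])
  show "cinner (adj A (A x)) y = cinner x (adj A (A y))" for x y
    by (simp add: cinner_adj'[OF A] flip: cinner_adj[OF A])
  show "0 \<le> Re (cinner (adj A (A x)) x)" for x by (simp add: cinner_adj'[OF A] cinner_self)
qed

lemma abs_op_eqI:
  fixes A :: "'a::complex_hilbert \<Rightarrow> 'a"
  assumes "positive_op P" "\<And>x. P (P x) = adj A (A x)"
  shows "abs_op A = P"
  unfolding abs_op_def
proof (rule the_equality)
  show "positive_op P \<and> P \<circ> P = adj A \<circ> A" using assms by (auto simp: fun_eq_iff)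
  fix P' assume "positive_op P' \<and> P' \<circ> P' = adj A \<circ> A"
  then show "P' = P" using assms by (intro positive_sqrt_unique) (auto simp: fun_eq_iff)
qed

text \<open>Existence and uniqueness of the square root of \<open>adj A \<circ> A\<close> give the
  \<open>THE\<close> in \<open>abs_op\<close> its value. The equality of norms is the hypothesis of
  Douglas factorization in both directions.\<close>

lemma
  fixes A :: "'a::complex_hilbert \<Rightarrow> 'a"
  assumes A: "bounded_clinear A"
  shows positive_abs_op: "positive_op (abs_op A)"
    and norm_abs_op_apply: "norm (abs_op A x) = norm (A x)"
proof -
  obtain Q where Q: "positive_op Q" "\<And>x. Q (Q x) = adj A (A x)"
    using positive_sqrt_exists[OF positive_op_adj_comp[OF A]] by metis
  then have *: "abs_op A = Q" by (rule abs_op_eqI)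
  then show "positive_op (abs_op A)" using Q by simp
  have "cinner (Q x) (Q x) = cinner (A x) (A x)"
    using positive_opD(2)[OF Q(1), of x "Q x"] by (simp add: Q(2) cinner_adj[OF A])
  then show "norm (abs_op A x) = norm (A x)" by (simp add: * norm_eq_sqrt_cinner)
qed

lemma abs_op_positive:
  fixes A :: "'a::complex_hilbert \<Rightarrow> 'a"
  shows "positive_op A \<Longrightarrow> abs_op A = A"
  by (rule abs_op_eqI) (simp_all add: positive_opD)

section \<open>Trace class operators\<close>

lemma cmod_cinner_commute: "cmod (cinner x y) = cmod (cinner y x)"
  by (subst cinner_commute) simp

text \<open>With \<open>P = Q \<circ> Q\<close> the diagonal entries are
  \<open>(norm (Q e))^2\<close>, and \<open>Q\<close> is its own adjoint, so the Hilbert-Schmidt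
  estimate moves from \<open>B\<close> to finite parts of \<open>B'\<close>. Exchanging the bases
  later gives equality.\<close>

lemma positive_diagonal_summable:
  fixes P :: "'a::complex_hilbert \<Rightarrow> 'a"
  assumes P: "positive_op P" and B: "is_onb B" and B': "is_onb B'"
    and s: "(\<lambda>e. Re (cinner (P e) e)) summable_on B"
  shows "(\<lambda>e. Re (cinner (P e) e)) summable_on B'"
    and "infsum (\<lambda>e. Re (cinner (P e) e)) B' \<le> infsum (\<lambda>e. Re (cinner (P e) e)) B"
proof -
  obtain Q where Q: "positive_op Q" "\<And>x. Q (Q x) = P x"
    using positive_sqrt_exists[OF P] by metis
  have n: "Re (cinner (P e) e) = (norm (Q e))\<^sup>2" for e
    using positive_opD(2)[OF Q(1), of "Q e" e] by (simp add: Q(2) cinner_self flip: of_real_power)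
  have *: "(\<Sum>e\<in>F. (norm (Q e))\<^sup>2) \<le> infsum (\<lambda>e. (norm (Q e))\<^sup>2) B"
    if "finite F" "F \<subseteq> B'" for F
    using sum_norm_adj_square_le[OF positive_opD(1)[OF Q(1)] B that(1)
        orthonormal_subset[OF orthonormal_onb[OF B'] that(2)]] s
    by (simp add: n positive_opD(4)[OF Q(1)])
  show s': "(\<lambda>e. Re (cinner (P e) e)) summable_on B'"
    unfolding n by (rule nonneg_bdd_above_summable_on) (use * in \<open>auto intro!: bdd_aboveI\<close>)
  show "infsum (\<lambda>e. Re (cinner (P e) e)) B' \<le> infsum (\<lambda>e. Re (cinner (P e) e)) B"
    using s' unfolding n by (rule infsum_le_finite_sums) (rule *)
qed

lemma positive_diagonal_real:
  fixes P :: "'a::complex_hilbert \<Rightarrow> 'a"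
  shows "positive_op P \<Longrightarrow> (\<lambda>e. cinner (P e) e) = (\<lambda>e. complex_of_real (Re (cinner (P e) e)))"
  using positive_opD(5)[of P] by (auto simp: fun_eq_iff complex_eq_iff less_eq_complex_def)

lemma some_onb: "is_onb (SOME B :: 'a::complex_inner set. is_onb B)"
  using onb_exists by (rule someI_ex)

lemma trace_class_clinear: "trace_class a \<Longrightarrow> bounded_clinear a"
  by (simp add: trace_class_def)

lemma trace_classI:
  fixes a :: "'a::complex_hilbert \<Rightarrow> 'a"
  assumes "bounded_clinear a" "is_onb B" "(\<lambda>e. Re (cinner (abs_op a e) e)) summable_on B"
  shows "trace_class a"
  unfolding trace_class_def using assms
  by (subst positive_diagonal_real[OF positive_abs_op]) (auto intro: summable_on_of_real)

text \<open>\<open>trace_class\<close> speaks of some basis and \<open>trace\<close> of a chosen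
  one; basis independence for the positive operator \<open>abs_op a\<close> frees both, so any
  \<open>B\<close> may be used from here on.\<close>

lemma trace_norm_has_sum:
  fixes a :: "'a::complex_hilbert \<Rightarrow> 'a"
  assumes a: "trace_class a" and B: "is_onb B"
  shows "((\<lambda>e. Re (cinner (abs_op a e) e)) has_sum trace_norm a) B"
    and "trace (abs_op a) = complex_of_real (trace_norm a)"
proof -
  have pos: "positive_op (abs_op a)" using a by (simp add: positive_abs_op trace_class_clinear)
  obtain B0 where B0: "is_onb B0" "(\<lambda>e. cinner (abs_op a e) e) summable_on B0"
    using a unfolding trace_class_def by blast
  have s: "(\<lambda>e. Re (cinner (abs_op a e) e)) summable_on C" if "is_onb C" for C
    using positive_diagonal_summable(1)[OF pos B0(1) that] summable_on_Re[OF B0(2)] by simp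
  define B1 :: "'a set" where "B1 = (SOME B. is_onb B)"
  have B1: "is_onb B1" unfolding B1_def by (rule some_onb)
  have "((\<lambda>e. cinner (abs_op a e) e) has_sum
    complex_of_real (infsum (\<lambda>e. Re (cinner (abs_op a e) e)) B1)) B1"
    by (subst positive_diagonal_real[OF pos]) (intro has_sum_of_real has_sum_infsum s B1)
  then have t: "trace (abs_op a) = complex_of_real (infsum (\<lambda>e. Re (cinner (abs_op a e) e)) B1)"
    unfolding trace_def B1_def[symmetric] by (rule infsumI)
  then have tn: "trace_norm a = infsum (\<lambda>e. Re (cinner (abs_op a e) e)) B1"
    unfolding trace_norm_def by simp
  also have "\<dots> = infsum (\<lambda>e. Re (cinner (abs_op a e) e)) B"
    by (intro antisym positive_diagonal_summable(2) pos B B1 s)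
  finally show "((\<lambda>e. Re (cinner (abs_op a e) e)) has_sum trace_norm a) B"
    using s[OF B] by simp
  show "trace (abs_op a) = complex_of_real (trace_norm a)" by (simp add: t tn)
qed

lemma trace_positive_has_sum:
  fixes P :: "'a::complex_hilbert \<Rightarrow> 'a"
  assumes "trace_class P" "positive_op P" "is_onb B"
  shows "((\<lambda>e. Re (cinner (P e) e)) has_sum Re (trace P)) B" and "Im (trace P) = 0"
  using trace_norm_has_sum[OF assms(1,3)] by (simp_all add: abs_op_positive[OF assms(2)])

text \<open>The weak form of \<open>a = \<Sum> |u i><v i|\<close>. The index set is left open
  because families over an orthonormal basis, a finite set and a single point all occur.\<close>

definition nuclear_series :: "'i set \<Rightarrow> ('i \<Rightarrow> 'b) \<Rightarrow> ('i \<Rightarrow> 'a) \<Rightarrow> ('a::complex_inner \<Rightarrow> 'b::complex_inner) \<Rightarrow> bool" where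
  "nuclear_series I u v a \<longleftrightarrow> (\<lambda>i. norm (u i) * norm (v i)) summable_on I \<and>
    (\<forall>x y. ((\<lambda>i. cinner x (v i) * cinner (u i) y) has_sum cinner (a x) y) I)"

text \<open>Writing \<open>|a| = W a\<close> with a contraction \<open>W\<close> turns the series of
  \<open>a\<close> into one for \<open>|a|\<close> with vectors \<open>W (u i)\<close>. Over
  finitely many basis vectors, each term contributes at most
  \<open>norm (v i) * norm (W (u i))\<close>, by Cauchy-Schwarz and Bessel.\<close>

lemma nuclear_series_trace_class:
  fixes a :: "'a::complex_hilbert \<Rightarrow> 'a"
  assumes a: "bounded_clinear a" and r: "nuclear_series I u v a"
  shows "trace_class a" and "trace_norm a \<le> infsum (\<lambda>i. norm (u i) * norm (v i)) I"
proof -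
  obtain B :: "'a set" where B: "is_onb B" using onb_exists by blast
  note pos = positive_abs_op[OF a]
  obtain W where W: "bounded_clinear W" "\<And>y. norm (W y) \<le> norm y" "\<And>x. abs_op a x = W (a x)"
    by (rule douglas_factorization[OF positive_opD(1)[OF pos] a]) (simp_all add: norm_abs_op_apply[OF a])
  let ?s = "infsum (\<lambda>i. norm (u i) * norm (v i)) I"
  have *: "(\<Sum>e\<in>F. Re (cinner (abs_op a e) e)) \<le> ?s" if F: "finite F" "F \<subseteq> B" for F
  proof -
    have "((\<lambda>i. cinner e (v i) * cinner (W (u i)) e) has_sum cinner (abs_op a e) e) I" for e
      using r unfolding nuclear_series_def W(3) cinner_adj[OF W(1)] by blast
    then have hs: "((\<lambda>i. \<Sum>e\<in>F. cinner e (v i) * cinner (W (u i)) e) has_sum (\<Sum>e\<in>F. cinner (abs_op a e) e)) I"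
      by (rule has_sum_sum)
    have "cmod (\<Sum>e\<in>F. cinner (abs_op a e) e) \<le> ?s"
    proof (rule norm_infsum_le[OF hs has_sum_infsum])
      show "(\<lambda>i. norm (u i) * norm (v i)) summable_on I" using r by (simp add: nuclear_series_def)
      fix i
      have sub: "(\<Sum>e\<in>G. (cmod (cinner x e))\<^sup>2) \<le> (norm x)\<^sup>2" if "finite G" "G \<subseteq> F" for G x
        by (rule bessel[OF that(1)])
          (use that F orthonormal_subset[OF orthonormal_onb[OF B]] in blast)
      have "cmod (\<Sum>e\<in>F. cinner e (v i) * cinner (W (u i)) e) \<le> norm (v i) * norm (W (u i))"
        using l2_product_complex(2)[of "norm (v i)" "norm (W (u i))" F "\<lambda>e. cinner e (v i)" "cinner (W (u i))"]
          sub F(1) by (simp add: cmod_cinner_commute[of _ "v i"])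
      also have "\<dots> \<le> norm (u i) * norm (v i)"
        using mult_left_mono[OF W(2)[of "u i"], of "norm (v i)"] by (simp add: mult.commute)
      finally show "cmod (\<Sum>e\<in>F. cinner e (v i) * cinner (W (u i)) e) \<le> norm (u i) * norm (v i)" .
    qed
    then show ?thesis using complex_Re_le_cmod[of "\<Sum>e\<in>F. cinner (abs_op a e) e"] by (simp add: Re_sum)
  qed
  show t: "trace_class a"
  proof (rule trace_classI[OF a B])
    show "(\<lambda>e. Re (cinner (abs_op a e) e)) summable_on B"
      by (rule nonneg_bdd_above_summable_on)
        (use * positive_opD(3)[OF pos] in \<open>auto intro!: bdd_aboveI\<close>)
  qed
  show "trace_norm a \<le> ?s"
    by (rule has_sum_le_finite_sums[OF trace_norm_has_sum(1)[OF t B]]) (rule *)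
qed

text \<open>With \<open>Q = |a|\<^bsup>1/2\<^esup>\<close> and \<open>a = U |a|\<close> one has \<open>a = \<Sum> |U Q e\<rangle>\<langle>Q e|\<close> over any orthonormal basis.\<close>

lemma trace_class_nuclear_series:
  fixes a :: "'a::complex_hilbert \<Rightarrow> 'a"
  assumes a: "trace_class a"
  obtains I :: "'a set" and u v where "nuclear_series I u v a"
    "infsum (\<lambda>i. norm (u i) * norm (v i)) I \<le> trace_norm a"
proof -
  obtain B :: "'a set" where B: "is_onb B" using onb_exists by blast
  note ac = trace_class_clinear[OF a]
  note pos = positive_abs_op[OF ac]
  obtain Q where Q: "positive_op Q" "\<And>x. Q (Q x) = abs_op a x"
    using positive_sqrt_exists[OF pos] by metis
  obtain U where U: "bounded_clinear U" "\<And>y. norm (U y) \<le> norm y" "\<And>x. a x = U (abs_op a x)"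
    by (rule douglas_factorization[OF ac positive_opD(1)[OF pos]]) (simp_all add: norm_abs_op_apply[OF ac])
  have n: "Re (cinner (abs_op a e) e) = (norm (Q e))\<^sup>2" for e
    using positive_opD(2)[OF Q(1), of "Q e" e] by (simp add: Q(2) cinner_self flip: of_real_power)
  have le: "norm (U (Q e)) * norm (Q e) \<le> Re (cinner (abs_op a e) e)" for e
    unfolding n power2_eq_square by (intro mult_right_mono U(2)) simp
  note hs = trace_norm_has_sum(1)[OF a B]
  have s: "(\<lambda>e. norm (U (Q e)) * norm (Q e)) summable_on B"
    by (rule summable_on_comparison_test[OF has_sum_imp_summable[OF hs]]) (use le in auto)
  show thesis
  proof
    show "nuclear_series B (\<lambda>e. U (Q e)) Q a"
      unfolding nuclear_series_def
    proof (intro conjI allI s)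
      fix x y
      \<comment> \<open>Parseval for \<open>Q x\<close> and \<open>Q (adj U y)\<close>: moving
        \<open>Q\<close> and \<open>U\<close> across the inner products gives
        \<open>cinner (U (Q (Q x))) y = cinner (a x) y\<close>.\<close>
      show "((\<lambda>e. cinner x (Q e) * cinner (U (Q e)) y) has_sum cinner (a x) y) B"
        using parseval[OF B, of "Q x" "Q (adj U y)"]
        by (simp add: U(3) cinner_adj[OF U(1)] positive_opD(2)[OF Q(1)] flip: Q(2))
    qed
    show "infsum (\<lambda>e. norm (U (Q e)) * norm (Q e)) B \<le> trace_norm a"
      using has_sum_mono[OF has_sum_infsum[OF s] hs le] by simp
  qed
qed

lemma trace_norm_nonneg:
  fixes a :: "'a::complex_hilbert \<Rightarrow> 'a"
  assumes a: "trace_class a"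
  shows "0 \<le> trace_norm a"
  by (rule has_sum_nonneg[OF trace_norm_has_sum(1)[OF a some_onb]])
    (rule positive_opD(3)[OF positive_abs_op[OF trace_class_clinear[OF a]]])

text \<open>Each term of a nuclear series obeys the same estimate with
  \<open>norm (u i) * norm (v i)\<close>. Through this bound, trace norm boundedness of \<mu>
  becomes a statement about matrix elements.\<close>

lemma cmod_cinner_trace_class_le:
  fixes a :: "'a::complex_hilbert \<Rightarrow> 'a"
  assumes a: "trace_class a"
  shows "cmod (cinner (a x) y) \<le> trace_norm a * (norm x * norm y)"
proof -
  obtain I :: "'a set" and u v where r: "nuclear_series I u v a"
    "infsum (\<lambda>i. norm (u i) * norm (v i)) I \<le> trace_norm a"
    by (rule trace_class_nuclear_series[OF a])
  have "cmod (cinner (a x) y) \<le> infsum (\<lambda>i. norm (u i) * norm (v i)) I * (norm x * norm y)"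
  proof (rule norm_infsum_le)
    show "((\<lambda>i. cinner x (v i) * cinner (u i) y) has_sum cinner (a x) y) I"
      using r(1) by (simp add: nuclear_series_def)
    show "((\<lambda>i. norm (u i) * norm (v i) * (norm x * norm y)) has_sum
      infsum (\<lambda>i. norm (u i) * norm (v i)) I * (norm x * norm y)) I"
      using r(1) by (intro has_sum_cmult_left has_sum_infsum) (simp add: nuclear_series_def)
    fix i
    have "cmod (cinner x (v i)) * cmod (cinner (u i) y) \<le> (norm x * norm (v i)) * (norm (u i) * norm y)"
      by (intro mult_mono cmod_cinner_le) auto
    then show "cmod (cinner x (v i) * cinner (u i) y) \<le> norm (u i) * norm (v i) * (norm x * norm y)"
      by (simp add: norm_mult mult_ac)
  qed
  also have "\<dots> \<le> trace_norm a * (norm x * norm y)" by (intro mult_right_mono r) simp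
  finally show ?thesis .
qed

text \<open>Conjugation exchanges the two families of a nuclear series.\<close>

lemma trace_class_adj:
  fixes a :: "'a::complex_hilbert \<Rightarrow> 'a"
  assumes a: "trace_class a"
  shows "trace_class (adj a)"
proof -
  note ac = trace_class_clinear[OF a]
  obtain I :: "'a set" and u v where r: "nuclear_series I u v a"
    by (rule trace_class_nuclear_series[OF a])
  have "nuclear_series I v u (adj a)"
    unfolding nuclear_series_def
  proof (intro conjI allI)
    show "(\<lambda>i. norm (v i) * norm (u i)) summable_on I"
      using r unfolding nuclear_series_def by (simp add: mult.commute)
    fix x y
    have "((\<lambda>i. cnj (cinner y (v i) * cinner (u i) x)) has_sum cnj (cinner (a y) x)) I"
      using r unfolding has_sum_cnj_iff nuclear_series_def by blast
    moreover have "cnj (cinner y (v i) * cinner (u i) x) = cinner x (u i) * cinner (v i) y" for i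
      by (simp add: cinner_commute[of x] cinner_commute[of _ y] mult.commute)
    moreover have "cnj (cinner (a y) x) = cinner (adj a x) y"
      by (simp add: cinner_adj'[OF ac] cinner_commute[of x])
    ultimately show "((\<lambda>i. cinner x (u i) * cinner (v i) y) has_sum cinner (adj a x) y) I" by simp
  qed
  then show ?thesis using nuclear_series_trace_class(1) bounded_clinear_adj[OF ac] by blast
qed

section \<open>Rank one operators \<open>|u><v|\<close> and finite parts of nuclear series\<close>

definition rank_one :: "'b \<Rightarrow> 'a \<Rightarrow> 'a::complex_inner \<Rightarrow> 'b::complex_inner" where
  "rank_one u v x = cinner x v *\<^sub>C u"

lemma cinner_rank_one: "cinner (rank_one u v x) y = cinner x v * cinner u y"
  by (simp add: rank_one_def cinner_scaleC_left)

lemma bounded_clinear_rank_one: "bounded_clinear (rank_one u v)"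
proof (rule bounded_clinearI)
  show "norm (rank_one u v x) \<le> norm u * norm v * norm x" for x
    using mult_right_mono[OF cmod_cinner_le[of x v] norm_ge_zero[of u]]
    by (simp add: rank_one_def norm_scaleC mult_ac)
qed (simp_all add: rank_one_def cinner_add_left scaleC_add_left cinner_scaleC_left scaleC_scaleC)

lemma adj_rank_one: "adj (rank_one u v) = rank_one v u"
  by (rule adj_eqI)
    (simp add: rank_one_def cinner_scaleC_left cinner_scaleC_right mult.commute flip: cinner_commute)

lemma nuclear_series_rank_one: "nuclear_series {()} (\<lambda>_. u) (\<lambda>_. v) (rank_one u v)"
  by (simp add: nuclear_series_def cinner_rank_one has_sum_finiteI)

lemma
  fixes u v :: "'a::complex_hilbert"
  shows trace_class_rank_one: "trace_class (rank_one u v)"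
    and trace_norm_rank_one_le: "trace_norm (rank_one u v) \<le> norm u * norm v"
  using nuclear_series_trace_class[OF bounded_clinear_rank_one nuclear_series_rank_one[of u v]] by simp_all

lemma positive_rank_one: "positive_op (rank_one u u)"
proof (rule positive_opI[OF bounded_clinear_rank_one])
  show "cinner (rank_one u u x) y = cinner x (rank_one u u y)" for x y
    by (simp add: rank_one_def cinner_scaleC_left cinner_scaleC_right mult.commute flip: cinner_commute)
  show "0 \<le> Re (cinner (rank_one u u x) x)" for x
    unfolding cinner_rank_one by (subst cinner_commute[of u]) (simp flip: complex_norm_square)
qed

lemma trace_rank_one:
  fixes u :: "'a::complex_hilbert"
  shows "trace (rank_one u u) = complex_of_real ((norm u)\<^sup>2)"
proof -
  obtain B :: "'a set" where B: "is_onb B" using onb_exists by blast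
  note * = trace_positive_has_sum[OF trace_class_rank_one positive_rank_one B, of u]
  have "Re (cinner (rank_one u u e) e) = (cmod (cinner u e))\<^sup>2" for e
  proof -
    have "cinner (rank_one u u e) e = complex_of_real ((cmod (cinner u e))\<^sup>2)"
      unfolding complex_norm_square cinner_rank_one by (simp add: cinner_commute[of e] mult.commute)
    then show ?thesis by simp
  qed
  then have "Re (trace (rank_one u u)) = (norm u)\<^sup>2"
    using has_sum_unique[OF *(1)] parseval_norm[OF B, of u] by simp
  then show ?thesis using *(2) by (simp add: complex_eq_iff)
qed

lemma finite_nuclear_series:
  assumes F: "finite F"
  shows "nuclear_series F u v (\<lambda>x. \<Sum>i\<in>F. rank_one (u i) (v i) x)"
  using F by (simp add: nuclear_series_def cinner.sum_left cinner_rank_one has_sum_finiteI)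

text \<open>The tail of the series represents the remainder, so the remainder's trace norm is at
  most the tail sum: finite partial sums approximate in trace norm.\<close>

lemma nuclear_series_diff:
  assumes r: "nuclear_series I u v a" and F: "finite F" "F \<subseteq> I"
  shows "nuclear_series (I - F) u v (\<lambda>x. a x - (\<Sum>i\<in>F. rank_one (u i) (v i) x))"
  unfolding nuclear_series_def
proof (intro conjI allI)
  show "(\<lambda>i. norm (u i) * norm (v i)) summable_on (I - F)"
    using r unfolding nuclear_series_def by (blast intro: summable_on_subset)
  show "((\<lambda>i. cinner x (v i) * cinner (u i) y) has_sum
    cinner (a x - (\<Sum>i\<in>F. rank_one (u i) (v i) x)) y) (I - F)" for x y
    unfolding cinner_diff_left
    by (rule has_sum_Diff) (use r finite_nuclear_series[OF F(1), of u v] F in \<open>auto simp: nuclear_series_def\<close>)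
qed

section \<open>Kraus operators give subchannels\<close>

lemma complex_sums_nonneg:
  fixes f :: "nat \<Rightarrow> complex"
  assumes "f sums s" "\<And>k. 0 \<le> f k"
  shows "0 \<le> s"
proof -
  have "(\<lambda>k. Re (f k)) sums Re s" "(\<lambda>k. Im (f k)) sums Im s"
    using assms(1) by (simp_all add: sums_complex_iff)
  moreover have "0 \<le> Re (f k)" "Im (f k) = 0" for k
    using assms(2)[of k] by (simp_all add: less_eq_complex_def)
  ultimately show ?thesis
    using sums_le[of "\<lambda>_. 0" "\<lambda>k. Re (f k)" 0 "Re s"] sums_unique2[of "\<lambda>_. 0" 0 "Im s"]
    by (simp add: less_eq_complex_def)
qed

lemma completely_positiveD:
  assumes "completely_positive \<mu>" "\<And>i j. i < n \<Longrightarrow> j < n \<Longrightarrow> trace_class (g i j)" "positive_op_matrix n g"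
  shows "positive_op_matrix n (\<lambda>i j. \<mu> (g i j))"
  using assms(1)[unfolded completely_positive_def, THEN conjunct2, THEN conjunct2, rule_format, of n g] assms(2,3)
  by simp

lemma completely_positive_positive_op:
  fixes \<mu> :: "('k::complex_hilbert \<Rightarrow> 'k) \<Rightarrow> ('h::complex_hilbert \<Rightarrow> 'h)"
  assumes cp: "completely_positive \<mu>" and g: "trace_class g" "positive_op g"
  shows "positive_op (\<mu> g)"
proof -
  have "positive_op_matrix 1 (\<lambda>_ _. g)"
    using g positive_opD[OF g(2)] by (auto simp: positive_op_matrix_def)
  then have "positive_op_matrix 1 (\<lambda>_ _. \<mu> g)"
    using completely_positiveD[OF cp, of 1 "\<lambda>_ _. g"] g by simp
  then have *: "bounded_clinear (\<mu> g)" "\<mu> g = adj (\<mu> g)"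
    "\<And>x. 0 \<le> (\<Sum>i<1. \<Sum>j<1. cinner (\<mu> g (x j)) (x (i::nat)))"
    unfolding positive_op_matrix_def by auto
  then have "0 \<le> cinner (\<mu> g x) x" for x using *(3)[of "\<lambda>_. x"] by simp
  then show ?thesis using * by (simp add: positive_op_def selfadjoint_def)
qed

text \<open>The operator inequality enters the trace estimate only as this bound on partial sums,
  which is also the form the opposite direction produces.\<close>

lemma kraus_sum_norm_le:
  assumes A: "\<And>i. bounded_clinear (A i :: 'k::complex_hilbert \<Rightarrow> 'h::complex_hilbert)"
    and S: "wot_sums (\<lambda>i. adj (A i) \<circ> A i) S" "op_le S id"
  shows "(\<Sum>k<N. (norm (A k x))\<^sup>2) \<le> (norm x)\<^sup>2"
proof -
  have "positive_op (\<lambda>x. id x - S x)" using S(2) by (simp add: op_le_def)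
  then have "Re (cinner (S x) x) \<le> (norm x)\<^sup>2"
    using positive_opD(3)[of "\<lambda>x. id x - S x" x]
    by (simp add: cinner_diff_left cinner_self flip: of_real_power)
  moreover have "(\<lambda>k. (norm (A k x))\<^sup>2) sums Re (cinner (S x) x)"
  proof -
    have "(\<lambda>k. cinner (adj (A k) (A k x)) x) sums cinner (S x) x"
      using S(1) by (simp add: wot_sums_def)
    then have "(\<lambda>k. Re (cinner (adj (A k) (A k x)) x)) sums Re (cinner (S x) x)"
      by (simp add: sums_complex_iff)
    then show ?thesis by (simp add: cinner_adj'[OF A] cinner_self flip: of_real_power)
  qed
  then have "(\<Sum>k<N. (norm (A k x))\<^sup>2) \<le> Re (cinner (S x) x)"
    using sum_le_suminf[of "\<lambda>k. (norm (A k x))\<^sup>2" "{..<N}"] by (simp add: sums_iff)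
  ultimately show ?thesis by simp
qed

text \<open>The \<open>k\<close>-th term of the form of \<open>[\<mu> (g i j)]\<close> at the
  vectors \<open>x i\<close> is the form of \<open>[g i j]\<close> at
  \<open>adj (A k) (x i)\<close>, hence nonnegative; a convergent series of nonnegative terms has a
  nonnegative sum.\<close>

lemma kraus_completely_positive:
  fixes \<mu> :: "('k::complex_hilbert \<Rightarrow> 'k) \<Rightarrow> ('h::complex_hilbert \<Rightarrow> 'h)"
  assumes \<mu>: "trace_class_bounded_clinear \<mu>"
    and A: "\<And>i. bounded_clinear (A i)"
    and K: "\<And>a x y. trace_class a \<Longrightarrow>
      (\<lambda>k. cinner (a (adj (A k) x)) (adj (A k) y)) sums cinner (\<mu> a x) y"
  shows "completely_positive \<mu>"
  unfolding completely_positive_def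
proof (intro conjI allI impI \<mu>)
  show adj: "adj (\<mu> g) = \<mu> (adj g)" if g: "trace_class g" for g
  proof (rule adj_eqI)
    fix x u
    note gc = trace_class_clinear[OF g]
    have "(\<lambda>k. cnj (cinner (adj g (adj (A k) u)) (adj (A k) x))) sums cnj (cinner (\<mu> (adj g) u) x)"
      unfolding sums_cnj by (rule K[OF trace_class_adj[OF g]])
    then have "(\<lambda>k. cinner (g (adj (A k) x)) (adj (A k) u)) sums cinner x (\<mu> (adj g) u)"
      by (simp add: cinner_adj[OF gc] flip: cinner_commute)
    then show "cinner (\<mu> g x) u = cinner x (\<mu> (adj g) u)"
      using K[OF g] sums_unique2 by blast
  qed
  fix n and g :: "nat \<Rightarrow> nat \<Rightarrow> 'k \<Rightarrow> 'k"
  assume t: "\<forall>i<n. \<forall>j<n. trace_class (g i j)" and p: "positive_op_matrix n g"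
  show "positive_op_matrix n (\<lambda>i j. \<mu> (g i j))"
    unfolding positive_op_matrix_def
  proof (intro conjI allI impI)
    fix i j assume ij: "i < n" "j < n"
    show "bounded_clinear (\<mu> (g i j))"
      using \<mu> t ij unfolding trace_class_bounded_clinear_def by (blast intro: trace_class_clinear)
    show "\<mu> (g i j) = adj (\<mu> (g j i))"
      using p t ij adj unfolding positive_op_matrix_def by metis
  next
    fix x :: "nat \<Rightarrow> 'h"
    have "(\<lambda>k. \<Sum>i<n. \<Sum>j<n. cinner (g i j (adj (A k) (x j))) (adj (A k) (x i))) sums
      (\<Sum>i<n. \<Sum>j<n. cinner (\<mu> (g i j) (x j)) (x i))"
      by (intro sums_sum K) (use t in auto)
    then show "0 \<le> (\<Sum>i<n. \<Sum>j<n. cinner (\<mu> (g i j) (x j)) (x i))"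
    proof (rule complex_sums_nonneg)
      show "0 \<le> (\<Sum>i<n. \<Sum>j<n. cinner (g i j (adj (A k) (x j))) (adj (A k) (x i)))" for k
        using p[unfolded positive_op_matrix_def, THEN conjunct2, THEN conjunct2, THEN spec,
            of "\<lambda>i. adj (A k) (x i)"] .
    qed
  qed
qed

text \<open>With \<open>g = Q\<^sup>2\<close>, the trace of \<open>\<mu> g\<close> is \<open>\<Sum> \<parallel>Q A\<^sub>k\<^sup>* e\<parallel>\<^sup>2 = \<Sum> \<parallel>A\<^sub>k Q f\<parallel>\<^sup>2 \<le> \<Sum> \<parallel>Q f\<parallel>\<^sup>2\<close>.\<close>

lemma kraus_trace_le:
  fixes \<mu> :: "('k::complex_hilbert \<Rightarrow> 'k) \<Rightarrow> ('h::complex_hilbert \<Rightarrow> 'h)"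
  assumes A: "\<And>i. bounded_clinear (A i)"
    and K: "\<And>x y. (\<lambda>k. cinner (g (adj (A k) x)) (adj (A k) y)) sums cinner (\<mu> g x) y"
    and le: "\<And>N x. (\<Sum>k<N. (norm (A k x))\<^sup>2) \<le> (norm x)\<^sup>2"
    and g: "trace_class g" "positive_op g" and \<mu>g: "trace_class (\<mu> g)" "positive_op (\<mu> g)"
  shows "trace (\<mu> g) \<le> trace g"
proof -
  obtain B :: "'h set" where B: "is_onb B" using onb_exists by blast
  obtain C :: "'k set" where C: "is_onb C" using onb_exists by blast
  obtain Q where Q: "positive_op Q" "\<And>x. Q (Q x) = g x"
    using positive_sqrt_exists[OF g(2)] by metis
  note QC = positive_opD(1)[OF Q(1)]
  have gQ: "cinner (g x) x = complex_of_real ((norm (Q x))\<^sup>2)" for x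
    using positive_opD(2)[OF Q(1), of "Q x" x] by (simp add: Q(2) cinner_self)
  have trg: "((\<lambda>f. (norm (Q f))\<^sup>2) has_sum Re (trace g)) C"
    using trace_positive_has_sum(1)[OF g C] by (simp add: gQ flip: of_real_power)
  have adjAQ: "adj (\<lambda>x. A k (Q x)) = (\<lambda>e. Q (adj (A k) e))" for k
    by (rule adj_eqI) (simp add: cinner_adj[OF A] positive_opD(2)[OF Q(1)])
  \<comment> \<open>One term of the bounded sum; it makes the squares of \<open>A k (Q f)\<close>
    summable over \<open>C\<close> by comparison with those of \<open>Q f\<close>.\<close>
  have Ale: "(norm (A k x))\<^sup>2 \<le> (norm x)\<^sup>2" for k x
    using le[where N = "Suc k" and x = x] sum_nonneg[OF zero_le_power2, of "\<lambda>k. norm (A k x)" "{..<k}"]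
    unfolding sum.lessThan_Suc by linarith
  have sA: "(\<lambda>f. (norm (A k (Q f)))\<^sup>2) summable_on C" for k
    by (rule summable_on_comparison_test[OF has_sum_imp_summable[OF trg]]) (auto simp: Ale)
  have "(\<Sum>e\<in>F. Re (cinner (\<mu> g e) e)) \<le> Re (trace g)" if F: "finite F" "F \<subseteq> B" for F
  proof -
    have on: "orthonormal F" using orthonormal_subset[OF orthonormal_onb[OF B] F(2)] .
    have "(\<lambda>k. \<Sum>e\<in>F. Re (cinner (g (adj (A k) e)) (adj (A k) e))) sums (\<Sum>e\<in>F. Re (cinner (\<mu> g e) e))"
      by (intro sums_sum) (use K in \<open>simp add: sums_complex_iff\<close>)
    then have "(\<lambda>N. \<Sum>k<N. \<Sum>e\<in>F. (norm (Q (adj (A k) e)))\<^sup>2) \<longlonglongrightarrow> (\<Sum>e\<in>F. Re (cinner (\<mu> g e) e))"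
      unfolding gQ Re_complex_of_real sums_def .
    moreover have "(\<Sum>k<N. \<Sum>e\<in>F. (norm (Q (adj (A k) e)))\<^sup>2) \<le> Re (trace g)" for N
    proof -
      have "(\<Sum>k<N. \<Sum>e\<in>F. (norm (Q (adj (A k) e)))\<^sup>2) \<le> (\<Sum>k<N. infsum (\<lambda>f. (norm (A k (Q f)))\<^sup>2) C)"
        using sum_norm_adj_square_le[OF bounded_clinear_compose[OF A QC] C F(1) on sA]
        by (intro sum_mono) (simp add: adjAQ)
      \<comment> \<open>The finite sum over \<open>k\<close> moves inside the sum over
        \<open>C\<close>, where \<open>le\<close> applies at each vector \<open>Q f\<close>. The
        bound does not depend on \<open>N\<close>.\<close>
      also have "\<dots> \<le> Re (trace g)"
        by (rule has_sum_mono[OF has_sum_sum[OF has_sum_infsum[OF sA]] trg]) (rule le)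
      finally show ?thesis .
    qed
    ultimately show ?thesis by (intro LIMSEQ_le_const2) blast+
  qed
  then have "Re (trace (\<mu> g)) \<le> Re (trace g)"
    by (rule has_sum_le_finite_sums[OF trace_positive_has_sum(1)[OF \<mu>g B]])
  then show ?thesis
    using trace_positive_has_sum(2)[OF g C] trace_positive_has_sum(2)[OF \<mu>g B]
    by (simp add: less_eq_complex_def)
qed

lemma kraus_imp_subchannel:
  fixes \<mu> :: "('k::complex_hilbert \<Rightarrow> 'k) \<Rightarrow> ('h::complex_hilbert \<Rightarrow> 'h)"
  assumes \<mu>: "trace_class_bounded_clinear \<mu>"
    and A: "\<And>i. bounded_clinear (A i)"
    and W: "\<And>a. trace_class a \<Longrightarrow> wot_sums (\<lambda>i. A i \<circ> a \<circ> adj (A i)) (\<mu> a)"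
    and S: "wot_sums (\<lambda>i. adj (A i) \<circ> A i) S" "op_le S id"
  shows "quantum_subchannel \<mu>"
proof -
  have K: "(\<lambda>k. cinner (a (adj (A k) x)) (adj (A k) y)) sums cinner (\<mu> a x) y"
    if "trace_class a" for a x y
    using W[OF that] unfolding wot_sums_def by (simp add: cinner_adj[OF A])
  have cp: "completely_positive \<mu>" by (rule kraus_completely_positive[OF \<mu> A K])
  show ?thesis
    unfolding quantum_subchannel_def
  proof (intro conjI allI impI cp)
    fix g :: "'k \<Rightarrow> 'k" assume "density_op g"
    then have g: "trace_class g" "positive_op g" by (simp_all add: density_op_def)
    show "trace (\<mu> g) \<le> trace g"
    proof (rule kraus_trace_le[where A = A])
      show "(\<lambda>k. cinner (g (adj (A k) x)) (adj (A k) y)) sums cinner (\<mu> g x) y" for x y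
        by (rule K[OF g(1)])
      show "(\<Sum>k<N. (norm (A k x))\<^sup>2) \<le> (norm x)\<^sup>2" for N x
        by (rule kraus_sum_norm_le[OF A S])
      show "trace_class (\<mu> g)" using \<mu> g by (simp add: trace_class_bounded_clinear_def)
      show "positive_op (\<mu> g)" by (rule completely_positive_positive_op[OF cp g])
    qed (use A g in auto)
  qed
qed

section \<open>Cholesky decomposition of positive kernels\<close>

text \<open>Hermitian symmetry makes the double sum real, so a condition on its real part suffices.
  The points \<open>p i\<close> may coincide, so a point can be appended without checking that it is
  new.\<close>

definition psd_kernel :: "('x \<Rightarrow> 'x \<Rightarrow> complex) \<Rightarrow> bool" where
  "psd_kernel K \<longleftrightarrow> (\<forall>p q. K p q = cnj (K q p)) \<and>
    (\<forall>n p c. 0 \<le> Re (\<Sum>i<n. \<Sum>j<n. c i * cnj (c j) * K (p i) (p (j::nat))))"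

lemma psd_kernelD:
  assumes "psd_kernel K"
  shows "K p q = cnj (K q p)" "0 \<le> Re (\<Sum>i<n. \<Sum>j<n. c i * cnj (c j) * K (r i) (r (j::nat)))"
  using assms unfolding psd_kernel_def by blast+

lemma psd_kernel_diag:
  assumes "psd_kernel K"
  shows "K p p = complex_of_real (Re (K p p))" "0 \<le> Re (K p p)"
proof -
  have "K p p = cnj (K p p)" using assms unfolding psd_kernel_def by blast
  then show "K p p = complex_of_real (Re (K p p))" by (simp add: complex_eq_iff)
  show "0 \<le> Re (K p p)"
    using psd_kernelD(2)[OF assms, where n = 1 and c = "\<lambda>_. 1" and r = "\<lambda>_. p"] by simp
qed

lemma psd_kernel_cauchy_schwarz:
  assumes K: "psd_kernel K"
  shows "(cmod (K p q))\<^sup>2 \<le> Re (K p p) * Re (K q q)"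
proof (rule psd_2x2_det)
  fix s t :: complex
  define c where "c = (\<lambda>i::nat. if i = 0 then s else t)"
  define r where "r = (\<lambda>i::nat. if i = 0 then p else q)"
  have "0 \<le> Re (\<Sum>i<2. \<Sum>j<2. c i * cnj (c j) * K (r i) (r j))"
    using K unfolding psd_kernel_def by blast
  also have "(\<Sum>i<2. \<Sum>j<2. c i * cnj (c j) * K (r i) (r j)) =
    s * cnj s * K p p + (s * cnj t * K p q + t * cnj s * K q p) + t * cnj t * K q q"
    by (simp add: c_def r_def numeral_2_eq_2)
  also have "t * cnj s * K q p = cnj (s * cnj t * K p q)"
    using K unfolding psd_kernel_def by (metis complex_cnj_cnj complex_cnj_mult mult.commute)
  also have "s * cnj s * K p p + (s * cnj t * K p q + cnj (s * cnj t * K p q)) + t * cnj t * K q q =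
    complex_of_real ((cmod s)\<^sup>2 * Re (K p p) + 2 * Re (s * cnj t * K p q) + (cmod t)\<^sup>2 * Re (K q q))"
    using psd_kernel_diag(1)[OF K, of p] psd_kernel_diag(1)[OF K, of q]
    unfolding of_real_add of_real_mult complex_norm_square complex_add_cnj by simp
  finally show "0 \<le> (cmod s)\<^sup>2 * Re (K p p) + 2 * Re (s * cnj t * K p q) + (cmod t)\<^sup>2 * Re (K q q)"
    by (simp only: Re_complex_of_real)
qed

text \<open>One elimination step, the Schur complement at the pivot \<open>z\<close>. If
  \<open>K z z = 0\<close>, the convention \<open>x / 0 = 0\<close> leaves \<open>K\<close>
  unchanged.\<close>

definition schur :: "('x \<Rightarrow> 'x \<Rightarrow> complex) \<Rightarrow> 'x \<Rightarrow> 'x \<Rightarrow> 'x \<Rightarrow> complex" where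
  "schur K z p q = K p q - K p z * K z q / K z z"

lemma psd_schur:
  assumes K: "psd_kernel K"
  shows "psd_kernel (schur K z)"
proof (cases "K z z = 0")
  case True
  then have "schur K z = K" by (simp add: schur_def fun_eq_iff)
  then show ?thesis using K by simp
next
  case False
  have H: "K p q = cnj (K q p)" for p q using K unfolding psd_kernel_def by blast
  define r where "r = K z z"
  have r: "cnj r = r" "r \<noteq> 0" using H[of z z] False unfolding r_def by auto
  show ?thesis
    unfolding psd_kernel_def
  proof (intro conjI allI)
    fix p q
    show "schur K z p q = cnj (schur K z q p)"
      using r(1) H[of z z] unfolding schur_def r_def
      by (simp flip: H add: mult.commute)
  next
    fix n :: nat and p c
    define s where "s = (\<Sum>i<n. c i * K (p i) z)"
    define T where "T = (\<Sum>i<n. \<Sum>j<n. c i * cnj (c j) * K (p i) (p j))"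
    \<comment> \<open>The coefficient of the appended point \<open>z\<close> that minimises the
      enlarged form; completing the square leaves \<open>T - s * cnj s / r\<close>, which is the
      form of the Schur complement.\<close>
    define d where "d = - s / r"
    have sc: "(\<Sum>j<n. cnj (c j) * K z (p j)) = cnj s"
        unfolding s_def by (simp flip: H)
    have e1: "(\<Sum>j<n. d * cnj (c j) * K z (p j)) = d * cnj s"
      unfolding sc[symmetric] by (simp add: sum_distrib_left mult.assoc)
    have e2: "(\<Sum>i<n. c i * cnj d * K (p i) z) = cnj d * s"
      unfolding s_def by (simp add: sum_distrib_left mult_ac)
    define c' where "c' = c(n := d)"
    define p' where "p' = p(n := z)"
    have "0 \<le> Re (\<Sum>i<Suc n. \<Sum>j<Suc n. c' i * cnj (c' j) * K (p' i) (p' j))"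
      using K unfolding psd_kernel_def by blast
    also have "(\<Sum>i<Suc n. \<Sum>j<Suc n. c' i * cnj (c' j) * K (p' i) (p' j)) =
      (\<Sum>i<n. (\<Sum>j<n. c i * cnj (c j) * K (p i) (p j)) + c i * cnj d * K (p i) z)
      + ((\<Sum>j<n. d * cnj (c j) * K z (p j)) + d * cnj d * r)"
      by (simp add: c'_def p'_def r_def)
    also have "\<dots> = T + cnj d * s + d * cnj s + d * cnj d * r"
      unfolding sum.distrib T_def[symmetric] e1 e2 by simp
    also have "\<dots> = T - s * cnj s / r" using r by (simp add: d_def field_simps)
    also have "\<dots> = (\<Sum>i<n. \<Sum>j<n. c i * cnj (c j) * schur K z (p i) (p j))"
    proof -
      have "s * cnj s / r = (\<Sum>i<n. \<Sum>j<n. (c i * K (p i) z) * (cnj (c j) * K z (p j)) / r)"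
      proof -
        have "s * cnj s / r = s * (\<Sum>j<n. cnj (c j) * K z (p j)) / r" by (simp only: sc)
        then show ?thesis unfolding s_def sum_product sum_divide_distrib .
      qed
      then show ?thesis
        unfolding T_def schur_def r_def by (simp add: algebra_simps flip: sum_subtractf)
    qed
    finally show "0 \<le> Re (\<Sum>i<n. \<Sum>j<n. c i * cnj (c j) * schur K z (p i) (p j))" .
  qed
qed

fun schur_iter :: "('x \<Rightarrow> 'x \<Rightarrow> complex) \<Rightarrow> (nat \<Rightarrow> 'x) \<Rightarrow> nat \<Rightarrow> 'x \<Rightarrow> 'x \<Rightarrow> complex" where
  "schur_iter K z 0 = K"
| "schur_iter K z (Suc n) = schur (schur_iter K z n) (z n)"

text \<open>The normalised column removed in step \<open>n\<close>. A zero pivot yields the zero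
  column, again by \<open>x / 0 = 0\<close>, so degenerate or repeated points do no harm.\<close>

definition cholesky :: "('x \<Rightarrow> 'x \<Rightarrow> complex) \<Rightarrow> (nat \<Rightarrow> 'x) \<Rightarrow> nat \<Rightarrow> 'x \<Rightarrow> complex" where
  "cholesky K z n p =
    schur_iter K z n p (z n) / complex_of_real (sqrt (Re (schur_iter K z n (z n) (z n))))"

lemma psd_schur_iter: "psd_kernel K \<Longrightarrow> psd_kernel (schur_iter K z n)"
  by (induction n) (auto intro: psd_schur)

lemma schur_iter_cholesky:
  assumes K: "psd_kernel K"
  shows "K p q = schur_iter K z n p q + (\<Sum>k<n. cholesky K z k p * cnj (cholesky K z k q))"
proof (induction n)
  case (Suc n)
  let ?R = "schur_iter K z n"
  note R = psd_schur_iter[OF K, of z n]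
  let ?r = "Re (?R (z n) (z n))"
  have "complex_of_real (sqrt ?r) * complex_of_real (sqrt ?r) = ?R (z n) (z n)"
    using psd_kernel_diag[OF R, of "z n"] by (simp flip: of_real_mult)
  then have "cholesky K z n p * cnj (cholesky K z n q) = ?R p (z n) * cnj (?R q (z n)) / ?R (z n) (z n)"
    by (simp add: cholesky_def)
  also have "cnj (?R q (z n)) = ?R (z n) q" using R unfolding psd_kernel_def by metis
  finally show ?case using Suc by (simp add: schur_def)
qed simp

text \<open>Elimination clears the column of its pivot and later steps keep it clear. For a zero
  pivot, Cauchy-Schwarz shows that the column was zero already.\<close>

lemma schur_iter_pivot:
  assumes K: "psd_kernel K"
  shows "k < n \<Longrightarrow> schur_iter K z n p (z k) = 0"
proof (induction n arbitrary: p)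
  case (Suc n)
  let ?R = "schur_iter K z n"
  note R = psd_schur_iter[OF K, of z n]
  show ?case
  proof (cases "k = n")
    case True
    have "?R p (z n) = 0" if "?R (z n) (z n) = 0"
      using psd_kernel_cauchy_schwarz[OF R, of p "z n"] that by simp
    then show ?thesis using True by (auto simp: schur_def)
  qed (use Suc in \<open>simp add: schur_def\<close>)
qed simp

text \<open>The remainder vanishes at \<open>z k\<close> after \<open>Suc k\<close> steps, so the
  partial sums are eventually constant. Only the second argument has to belong to the
  sequence.\<close>

lemma cholesky_sums:
  assumes K: "psd_kernel K"
  shows "(\<lambda>n. cholesky K z n p * cnj (cholesky K z n (z k))) sums K p (z k)"
proof -
  have "(\<Sum>j<n. cholesky K z j p * cnj (cholesky K z j (z k))) = K p (z k)" if "n \<ge> Suc k" for n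
    using schur_iter_cholesky[OF K, of p "z k" z n] schur_iter_pivot[OF K, of k n z p] that by simp
  then have "eventually (\<lambda>n. (\<Sum>j<n. cholesky K z j p * cnj (cholesky K z j (z k))) = K p (z k)) sequentially"
    by (auto simp: eventually_sequentially)
  then show ?thesis unfolding sums_def by (rule tendsto_eventually)
qed

lemma cholesky_square_sum_le:
  assumes K: "psd_kernel K"
  shows "(\<Sum>k<n. (cmod (cholesky K z k p))\<^sup>2) \<le> Re (K p p)"
proof -
  have "(\<Sum>k<n. cholesky K z k p * cnj (cholesky K z k p)) = complex_of_real (\<Sum>k<n. (cmod (cholesky K z k p))\<^sup>2)"
    by (simp only: complex_norm_square of_real_sum)
  then have "K p p = schur_iter K z n p p + complex_of_real (\<Sum>k<n. (cmod (cholesky K z k p))\<^sup>2)"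
    using schur_iter_cholesky[OF K, of p p z n] by simp
  then show ?thesis using psd_kernel_diag(2)[OF psd_schur_iter[OF K, of z n], of p] by simp
qed

section \<open>Sesquilinearity of the Cholesky factors\<close>

definition sesquilinear :: "('a::complex_inner \<times> 'b::complex_inner \<Rightarrow> complex) \<Rightarrow> bool" where
  "sesquilinear f \<longleftrightarrow> (\<forall>u u' y. f (u + u', y) = f (u, y) + f (u', y)) \<and>
    (\<forall>c u y. f (c *\<^sub>C u, y) = c * f (u, y)) \<and>
    (\<forall>u y y'. f (u, y + y') = f (u, y) + f (u, y')) \<and>
    (\<forall>c u y. f (u, c *\<^sub>C y) = cnj c * f (u, y))"

text \<open>A Schur complement subtracts multiples of one column from another, so in the first
  argument everything stays in the span of the columns of \<open>K\<close>.\<close>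

lemma sesquilinear_schur_iter:
  "(\<And>q. sesquilinear (\<lambda>p. K p q)) \<Longrightarrow> sesquilinear (\<lambda>p. schur_iter K z n p q)"
proof (induction n arbitrary: q)
  case (Suc n)
  then show ?case unfolding schur_iter.simps schur_def sesquilinear_def
    by (simp add: algebra_simps add_divide_distrib)
qed simp

lemma sesquilinear_cholesky:
  "(\<And>q. sesquilinear (\<lambda>p. K p q)) \<Longrightarrow> sesquilinear (cholesky K z n)"
  using sesquilinear_schur_iter[of K z n "z n"]
  unfolding cholesky_def[abs_def] sesquilinear_def by (simp add: add_divide_distrib)

section \<open>Kraus operators of a subchannel\<close>

lemma
  fixes \<mu> :: "('k::complex_hilbert \<Rightarrow> 'k) \<Rightarrow> ('h::complex_hilbert \<Rightarrow> 'h)"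
  assumes "trace_class_bounded_clinear \<mu>"
  shows trace_class_map: "trace_class a \<Longrightarrow> trace_class (\<mu> a)"
    and map_add: "trace_class a \<Longrightarrow> trace_class b \<Longrightarrow> \<mu> (\<lambda>x. a x + b x) = (\<lambda>x. \<mu> a x + \<mu> b x)"
    and map_scaleC: "trace_class a \<Longrightarrow> \<mu> (\<lambda>x. c *\<^sub>C a x) = (\<lambda>x. c *\<^sub>C \<mu> a x)"
  using assms unfolding trace_class_bounded_clinear_def by blast+

lemma trace_class_map_bound:
  fixes \<mu> :: "('k::complex_hilbert \<Rightarrow> 'k) \<Rightarrow> ('h::complex_hilbert \<Rightarrow> 'h)"
  assumes \<mu>: "trace_class_bounded_clinear \<mu>"
  obtains C where "C \<ge> 0"
    "\<And>a x y. trace_class a \<Longrightarrow> cmod (cinner (\<mu> a x) y) \<le> C * trace_norm a * (norm x * norm y)"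
proof -
  obtain C where C: "\<And>a. trace_class a \<Longrightarrow> trace_norm (\<mu> a) \<le> C * trace_norm a"
    using \<mu> unfolding trace_class_bounded_clinear_def by blast
  show thesis
  proof
    \<comment> \<open>The constant in the definition may be negative when all trace norms vanish,
      hence the absolute value.\<close>
    show "\<bar>C\<bar> \<ge> 0" by simp
    fix a :: "'k \<Rightarrow> 'k" and x y :: 'h assume a: "trace_class a"
    have "trace_norm (\<mu> a) \<le> \<bar>C\<bar> * trace_norm a"
      using C[OF a] mult_right_mono[OF abs_ge_self[of C] trace_norm_nonneg[OF a]] by linarith
    then have "trace_norm (\<mu> a) * (norm x * norm y) \<le> \<bar>C\<bar> * trace_norm a * (norm x * norm y)"
      by (intro mult_right_mono) auto
    then show "cmod (cinner (\<mu> a x) y) \<le> \<bar>C\<bar> * trace_norm a * (norm x * norm y)"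
      using cmod_cinner_trace_class_le[OF trace_class_map[OF \<mu> a], of x y] by linarith
  qed
qed

lemma trace_class_finite_rank: 
  fixes u v :: "'i \<Rightarrow> 'a::complex_hilbert"
  shows "finite F \<Longrightarrow> trace_class (\<lambda>x. \<Sum>i\<in>F. rank_one (u i) (v i) x)"
  by (rule nuclear_series_trace_class(1)[OF _ finite_nuclear_series])
    (auto intro: bounded_clinear_sum bounded_clinear_rank_one)

lemma map_finite_rank:
  fixes \<mu> :: "('k::complex_hilbert \<Rightarrow> 'k) \<Rightarrow> ('h::complex_hilbert \<Rightarrow> 'h)"
  assumes \<mu>: "trace_class_bounded_clinear \<mu>" and "finite F"
  shows "\<mu> (\<lambda>x. \<Sum>i\<in>F. rank_one (u i) (v i) x) = (\<lambda>x. \<Sum>i\<in>F. \<mu> (rank_one (u i) (v i)) x)"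
  using assms(2)
proof (induction F rule: finite_induct)
  case empty
  then show ?case
    using map_scaleC[OF \<mu> trace_class_rank_one[of 0 0], of 0] by simp
next
  case (insert i F)
  then show ?case
    using map_add[OF \<mu> trace_class_rank_one[of "u i" "v i"] trace_class_finite_rank[of F u v]] by simp
qed

text \<open>\<mu> is additive on finite partial sums, and the remainder has trace norm at most the
  tail of the norm series, so boundedness makes its image vanish in the limit.\<close>

lemma map_nuclear_series_has_sum:
  fixes \<mu> :: "('k::complex_hilbert \<Rightarrow> 'k) \<Rightarrow> ('h::complex_hilbert \<Rightarrow> 'h)"
  assumes \<mu>: "trace_class_bounded_clinear \<mu>" and a: "trace_class a" and r: "nuclear_series I u v a"
  shows "((\<lambda>i. cinner (\<mu> (rank_one (u i) (v i)) x) y) has_sum cinner (\<mu> a x) y) I"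
proof -
  obtain C where C: "C \<ge> 0"
    "\<And>a x y. trace_class a \<Longrightarrow> cmod (cinner (\<mu> a x) y) \<le> C * trace_norm a * (norm x * norm y)"
    using trace_class_map_bound[OF \<mu>] by blast
  define t where "t = (\<lambda>i. norm (u i) * norm (v i))"
  have ts: "t summable_on I" using r by (simp add: nuclear_series_def t_def)
  define f where "f i = cinner (\<mu> (rank_one (u i) (v i)) x) y" for i
  have est: "cmod (sum f F - cinner (\<mu> a x) y) \<le> C * (infsum t I - sum t F) * (norm x * norm y)"
    if F: "finite F" "F \<subseteq> I" for F
  proof -
    define b where "b = (\<lambda>x. \<Sum>i\<in>F. rank_one (u i) (v i) x)"
    define d where "d = (\<lambda>x. a x - b x)"
    have b: "trace_class b" unfolding b_def by (rule trace_class_finite_rank[OF F(1)])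
    have "bounded_clinear d" unfolding d_def
      by (rule bounded_clinear_diff) (rule trace_class_clinear, fact)+
    moreover have "nuclear_series (I - F) u v d"
      unfolding d_def b_def by (rule nuclear_series_diff[OF r F])
    ultimately have d: "trace_class d" "trace_norm d \<le> infsum t (I - F)"
      unfolding t_def by (rule nuclear_series_trace_class)+
    have "(t has_sum (infsum t I - sum t F)) (I - F)"
      by (rule has_sum_Diff[OF has_sum_infsum[OF ts]]) (use F in auto)
    then have tail: "infsum t (I - F) = infsum t I - sum t F" by (rule infsumI)
    have "\<mu> a = (\<lambda>x. \<mu> d x + \<mu> b x)"
      using map_add[OF \<mu> d(1) b] unfolding d_def by simp
    then have "cinner (\<mu> a x) y = cinner (\<mu> d x) y + sum f F"
      unfolding b_def map_finite_rank[OF \<mu> F(1)] f_def by (simp add: cinner_add_left cinner.sum_left)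
    then have "cmod (sum f F - cinner (\<mu> a x) y) = cmod (cinner (\<mu> d x) y)"
      by simp
    also have "\<dots> \<le> C * trace_norm d * (norm x * norm y)" by (rule C(2)[OF d(1)])
    also have "\<dots> \<le> C * (infsum t I - sum t F) * (norm x * norm y)"
      using d(2) C(1) unfolding tail by (intro mult_right_mono mult_left_mono) auto
    finally show ?thesis .
  qed
  have "((\<lambda>F. C * (infsum t I - sum t F) * (norm x * norm y)) \<longlongrightarrow> C * (infsum t I - infsum t I) * (norm x * norm y))
    (finite_subsets_at_top I)"
    by (intro tendsto_intros) (use has_sum_infsum[OF ts] in \<open>simp add: has_sum_def\<close>)
  then have "((\<lambda>F. sum f F - cinner (\<mu> a x) y) \<longlongrightarrow> 0) (finite_subsets_at_top I)"
    by (intro Lim_null_comparison[OF eventually_finite_subsets_at_top_weakI[OF est]]) auto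
  then show ?thesis unfolding has_sum_def f_def by (simp add: Lim_null[symmetric])
qed

text \<open>A form of the Choi matrix of \<open>\<mu>\<close> that needs no choice of basis.\<close>

definition choi :: "(('k::complex_hilbert \<Rightarrow> 'k) \<Rightarrow> ('h::complex_hilbert \<Rightarrow> 'h)) \<Rightarrow> 'k \<times> 'h \<Rightarrow> 'k \<times> 'h \<Rightarrow> complex" where
  "choi \<mu> p q = cinner (\<mu> (rank_one (fst p) (fst q)) (snd q)) (snd p)"

lemma rank_one_linear:
  "rank_one (u + u') v = (\<lambda>x. rank_one u v x + rank_one u' v x)"
  "rank_one (c *\<^sub>C u) v = (\<lambda>x. c *\<^sub>C rank_one u v x)"
  "rank_one u (v + v') = (\<lambda>x. rank_one u v x + rank_one u v' x)"
  "rank_one u (c *\<^sub>C v) = (\<lambda>x. cnj c *\<^sub>C rank_one u v x)"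
  by (simp_all add: fun_eq_iff rank_one_def scaleC_add_right scaleC_add_left scaleC_scaleC
      cinner_add_right cinner_scaleC_right mult.commute)

lemma completely_positive_adj:
  "completely_positive \<mu> \<Longrightarrow> trace_class g \<Longrightarrow> adj (\<mu> g) = \<mu> (adj g)"
  by (simp add: completely_positive_def)

lemma sesquilinear_choi:
  assumes \<mu>: "trace_class_bounded_clinear \<mu>"
  shows "sesquilinear (\<lambda>p. choi \<mu> p q)"
  unfolding sesquilinear_def choi_def
  by (simp add: rank_one_linear map_add[OF \<mu>] map_scaleC[OF \<mu>] trace_class_rank_one
      cinner_add_left cinner_add_right cinner_scaleC_left cinner_scaleC_right)

text \<open>The matrix \<open>[rank_one (u i) (u j)]\<close> is positive, its form being the squared
  modulus of the sum of the \<open>cinner (u i) (x i)\<close>. Complete positivity carries this over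
  to its image under \<mu>.\<close>

lemma psd_choi:
  fixes \<mu> :: "('k::complex_hilbert \<Rightarrow> 'k) \<Rightarrow> ('h::complex_hilbert \<Rightarrow> 'h)"
  assumes cp: "completely_positive \<mu>"
  shows "psd_kernel (choi \<mu>)"
  unfolding psd_kernel_def
proof (intro conjI allI)
  have \<mu>: "trace_class_bounded_clinear \<mu>" using cp by (simp add: completely_positive_def)
  show "choi \<mu> p q = cnj (choi \<mu> q p)" for p q
  proof -
    have "adj (\<mu> (rank_one (fst p) (fst q))) = \<mu> (rank_one (fst q) (fst p))"
      using completely_positive_adj[OF cp trace_class_rank_one] by (simp add: adj_rank_one)
    then show ?thesis
      unfolding choi_def
      using cinner_adj[OF trace_class_clinear[OF trace_class_map[OF \<mu> trace_class_rank_one]],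
          of "fst p" "fst q" "snd q" "snd p"]
      by (simp flip: cinner_commute)
  qed
  fix n :: nat and p :: "nat \<Rightarrow> 'k \<times> 'h" and c
  define g where "g = (\<lambda>i j. rank_one (fst (p i)) (fst (p j)))"
  have "positive_op_matrix n g"
    unfolding positive_op_matrix_def
  proof (intro conjI allI impI)
    show "bounded_clinear (g i j)" "g i j = adj (g j i)" for i j
      by (simp_all add: g_def bounded_clinear_rank_one adj_rank_one)
    fix x :: "nat \<Rightarrow> 'k"
    define s where "s = (\<Sum>i<n. cinner (fst (p i)) (x i))"
    have "(\<Sum>i<n. \<Sum>j<n. cinner (g i j (x j)) (x i)) = s * cnj s"
      unfolding s_def cnj_sum sum_product g_def cinner_rank_one
      by (simp add: mult.commute flip: cinner_commute)
    also have "\<dots> = complex_of_real ((cmod s)\<^sup>2)" by (simp only: complex_norm_square)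
    finally show "0 \<le> (\<Sum>i<n. \<Sum>j<n. cinner (g i j (x j)) (x i))" by (simp add: less_eq_complex_def)
  qed
  then have "positive_op_matrix n (\<lambda>i j. \<mu> (g i j))"
    by (rule completely_positiveD[OF cp, rotated]) (simp add: g_def trace_class_rank_one)
  \<comment> \<open>The coefficients are conjugated because the second component of the first kernel
    argument stands in the conjugate linear slot of \<open>cinner\<close>.\<close>
  from this[unfolded positive_op_matrix_def, THEN conjunct2, THEN conjunct2, THEN spec,
      of "\<lambda>i. cnj (c i) *\<^sub>C snd (p i)"]
  have "0 \<le> (\<Sum>i<n. \<Sum>j<n. c i * cnj (c j) * choi \<mu> (p i) (p j))"
    unfolding choi_def g_def
    by (simp add: bounded_clinearD[OF trace_class_clinear[OF trace_class_map[OF \<mu> trace_class_rank_one]]]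
        cinner_scaleC_left cinner_scaleC_right mult_ac)
  then show "0 \<le> Re (\<Sum>i<n. \<Sum>j<n. c i * cnj (c j) * choi \<mu> (p i) (p j))"
    by (simp add: less_eq_complex_def)
qed

text \<open>Enumerating a product \<open>D \<times> E\<close>, and not just any dense set of pairs,
  allows the two arguments to be extended by continuity one after the other.\<close>

lemma dense_sequence:
  assumes "separable_space (euclidean :: 'a::topological_space topology)"
    and "separable_space (euclidean :: 'b::topological_space topology)"
  obtains z :: "nat \<Rightarrow> 'a::topological_space \<times> 'b::topological_space" and D E where
    "closure D = UNIV" "closure E = UNIV" "range z = D \<times> E"
proof -
  obtain D :: "'a set" where D: "countable D" "closure D = UNIV"
    using assms(1) unfolding separable_space_def by auto
  obtain E :: "'b set" where E: "countable E" "closure E = UNIV"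
    using assms(2) unfolding separable_space_def by auto
  have "D \<times> E \<noteq> {}" using D(2) E(2) by force
  then have "range (from_nat_into (D \<times> E)) = D \<times> E"
    using D E by (intro range_from_nat_into) auto
  then show thesis using D E that by blast
qed

text \<open>Continuity in \<open>x\<close> for \<open>v\<close> in \<open>D\<close> comes first,
  then continuity in \<open>v\<close> for every \<open>x\<close>.\<close>

lemma form_eq_zero_dense:
  fixes P :: "'h::complex_inner \<Rightarrow> 'k::complex_inner"
  assumes P: "bounded_clinear P" and D: "closure D = UNIV" "closure E = UNIV"
    and 0: "\<And>v x. v \<in> D \<Longrightarrow> x \<in> E \<Longrightarrow> cinner (P x) v = 0"
  shows "cinner (P x) v = 0"
proof -
  have "cinner (P x) v = 0" if "v \<in> D" for x v
  proof (rule continuous_constant_on_closure[of E "\<lambda>x. cinner (P x) v"])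
    show "continuous_on (closure E) (\<lambda>x. cinner (P x) v)"
      by (rule linear_continuous_on)
        (rule bounded_linear_compose[OF cinner.bounded_linear_left bounded_clinearD(1)[OF P]])
  qed (use 0 that D in auto)
  then show ?thesis
    by (rule continuous_constant_on_closure[of D "cinner (P x)",
          OF linear_continuous_on[OF cinner.bounded_linear_right]]) (use D in auto)
qed

lemma kraus_operators_rank_one:
  fixes \<mu> :: "('k::complex_hilbert \<Rightarrow> 'k) \<Rightarrow> ('h::complex_hilbert \<Rightarrow> 'h)"
  assumes sep: "separable_space (euclidean :: 'k topology)" "separable_space (euclidean :: 'h topology)"
    and cp: "completely_positive \<mu>"
  obtains A where "\<And>k::nat. bounded_clinear (A k)"
    "\<And>u v x y. ((\<lambda>k. cinner (A k u) y * cnj (cinner (A k v) x)) has_sum cinner (\<mu> (rank_one u v) x) y) UNIV"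
    "\<And>n u y. (\<Sum>k<n. (cmod (cinner (A k u) y))\<^sup>2) \<le> Re (cinner (\<mu> (rank_one u u) y) y)"
proof -
  have \<mu>: "trace_class_bounded_clinear \<mu>" using cp by (simp add: completely_positive_def)
  obtain C where C: "C \<ge> 0"
    "\<And>a x y. trace_class a \<Longrightarrow> cmod (cinner (\<mu> a x) y) \<le> C * trace_norm a * (norm x * norm y)"
    using trace_class_map_bound[OF \<mu>] by blast
  have Cr: "cmod (cinner (\<mu> (rank_one u v) x) y) \<le> C * norm u * norm v * norm x * norm y" for u v x y
  proof -
    have "cmod (cinner (\<mu> (rank_one u v) x) y) \<le> C * trace_norm (rank_one u v) * (norm x * norm y)"
      by (rule C(2)[OF trace_class_rank_one])
    also have "\<dots> \<le> C * (norm u * norm v) * (norm x * norm y)"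
      by (intro mult_right_mono mult_left_mono trace_norm_rank_one_le C(1)) simp
    finally show ?thesis by (simp add: mult.assoc)
  qed
  obtain z :: "nat \<Rightarrow> 'k \<times> 'h" and D E where z: "closure D = UNIV" "closure E = UNIV" "range z = D \<times> E"
    by (rule dense_sequence[OF sep])
  note psd = psd_choi[OF cp]
  let ?L = "cholesky (choi \<mu>) z"
  \<comment> \<open>Serves twice: a single index gives the boundedness that turns a factor into an
    operator, arbitrary finite sets give absolute convergence of the Kraus series.\<close>
  have sq: "(\<Sum>k\<in>F. (cmod (?L k (u, y)))\<^sup>2) \<le> (sqrt C * norm u * norm y)\<^sup>2" if "finite F" for F u y
  proof -
    obtain n where n: "F \<subseteq> {..<n}" using \<open>finite F\<close> finite_nat_iff_bounded by blast
    then have "(\<Sum>k\<in>F. (cmod (?L k (u, y)))\<^sup>2) \<le> (\<Sum>k<n. (cmod (?L k (u, y)))\<^sup>2)"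
      by (intro sum_mono2) auto
    also have "\<dots> \<le> Re (choi \<mu> (u, y) (u, y))" by (rule cholesky_square_sum_le[OF psd])
    also have "\<dots> \<le> C * norm u * norm u * norm y * norm y"
      using complex_Re_le_cmod Cr[of u u y y] order.trans unfolding choi_def by fastforce
    also have "\<dots> = (sqrt C * norm u * norm y)\<^sup>2"
      using C(1) unfolding power_mult_distrib by (simp add: power2_eq_square)
    finally show ?thesis .
  qed
  have ses: "sesquilinear (?L k)" for k by (rule sesquilinear_cholesky) (rule sesquilinear_choi[OF \<mu>])
  have "\<exists>A. bounded_clinear A \<and> (\<forall>u y. cinner (A u) y = ?L k (u, y))" for k
  proof -
    have b: "cmod (?L k (u, y)) \<le> sqrt C * norm u * norm y" for u y
      using sq[of "{k}" u y] by (auto intro: power2_le_imp_le simp: C(1))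
    obtain A where "bounded_clinear A" "\<And>u y. cinner (A u) y = ?L k (u, y)"
      by (rule bounded_form_represented[of "\<lambda>u y. ?L k (u, y)", OF _ _ _ _ b])
        (use ses[of k] C(1) in \<open>auto simp: sesquilinear_def\<close>)
    then show ?thesis by blast
  qed
  then obtain A where A: "\<And>k. bounded_clinear (A k)" "\<And>k u y. cinner (A k u) y = ?L k (u, y)" by metis
  have sm: "(\<lambda>k. cinner (A k u) y * cnj (cinner (A k v) x)) summable_on UNIV"
    and bd: "cmod (infsum (\<lambda>k. cinner (A k u) y * cnj (cinner (A k v) x)) UNIV)
      \<le> sqrt C * norm u * norm y * (sqrt C * norm v * norm x)" for u v x y
    using l2_product_complex(1,2)[of "sqrt C * norm u * norm y" "sqrt C * norm v * norm x" UNIV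
        "\<lambda>k. cinner (A k u) y" "\<lambda>k. cnj (cinner (A k v) x)"] sq C(1)
    by (simp_all add: A(2))
  have hs: "((\<lambda>k. cinner (A k u) y * cnj (cinner (A k v) x)) has_sum cinner (\<mu> (rank_one u v) x) y) UNIV"
    for u v x y
  proof -
    define G where "G x v = infsum (\<lambda>k. cinner (A k u) y * cnj (cinner (A k v) x)) UNIV" for x v
    \<comment> \<open>The error of the Kraus formula for fixed \<open>u\<close> and
      \<open>y\<close>. As a bounded form in \<open>(x, v)\<close> it is represented by an operator
      \<open>P\<close>, so it only has to be checked on the enumerated pairs.\<close>
    define H where "H x v = choi \<mu> (u, y) (v, x) - G x v" for x v
    have Hb: "cmod (H x v) \<le> 2 * C * norm u * norm y * norm x * norm v" for x v
    proof -
      have "cmod (H x v) \<le> cmod (choi \<mu> (u, y) (v, x)) + cmod (G x v)"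
        unfolding H_def by (rule norm_triangle_ineq4)
      also have "cmod (choi \<mu> (u, y) (v, x)) \<le> C * norm u * norm v * norm x * norm y"
        unfolding choi_def using Cr by simp
      also have "cmod (G x v) \<le> C * norm u * norm v * norm x * norm y"
      proof -
        have "sqrt C * norm u * norm y * (sqrt C * norm v * norm x)
          = (sqrt C * sqrt C) * norm u * norm v * norm x * norm y" by (simp only: mult_ac)
        also have "sqrt C * sqrt C = C" using C(1) by simp
        finally show ?thesis using bd[of u y v x] unfolding G_def by (simp only:)
      qed
      finally show ?thesis by (simp add: mult_ac)
    qed
    \<comment> \<open>Hermitian symmetry transfers sesquilinearity from the first to the second
      argument of the kernel.\<close>
    have cs: "choi \<mu> (u, y) q = cnj (choi \<mu> q (u, y))" for q using psd_kernelD(1)[OF psd] .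
    note cl = sesquilinear_choi[OF \<mu>, of "(u, y)", unfolded sesquilinear_def]
    obtain P where P: "bounded_clinear P" "\<And>x v. cinner (P x) v = H x v"
    proof (rule bounded_form_represented[of H, OF _ _ _ _ Hb])
      show "H (x + x') v = H x v + H x' v" for x x' v
        unfolding H_def G_def cs using cl
        by (simp add: cinner_add_right distrib_left infsum_add sm)
      show "H (c *\<^sub>C x) v = c * H x v" for c x v
        unfolding H_def G_def cs using cl
        by (simp add: cinner_scaleC_right mult.left_commute infsum_cmult_right' right_diff_distrib)
      show "H x (v + v') = H x v + H x v'" for x v v'
        unfolding H_def G_def cs using cl
        by (simp add: cinner_add_left distrib_left infsum_add sm bounded_clinearD(2)[OF A(1)])
      show "H x (c *\<^sub>C v) = cnj c * H x v" for c x v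
        unfolding H_def G_def cs using cl
        by (simp add: cinner_scaleC_left mult.left_commute infsum_cmult_right' right_diff_distrib
            bounded_clinearD(3)[OF A(1)])
    qed (use C(1) in auto)
    have "cinner (P x) v = 0" for x v
    proof (rule form_eq_zero_dense[OF P(1) z(1,2)])
      fix v x assume "v \<in> D" "x \<in> E"
      then obtain k where k: "z k = (v, x)" using z(3) by (metis SigmaI imageE)
      have "(\<lambda>n. cinner (A n u) y * cnj (cinner (A n v) x)) sums choi \<mu> (u, y) (v, x)"
        using cholesky_sums[OF psd, of z "(u, y)" k] unfolding k A(2) .
      moreover have "(\<lambda>n. cinner (A n u) y * cnj (cinner (A n v) x)) sums G x v"
        unfolding G_def by (intro has_sum_imp_sums has_sum_infsum sm)
      ultimately show "cinner (P x) v = 0" unfolding P(2) H_def using sums_unique2 by fastforce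
    qed
    then have "choi \<mu> (u, y) (v, x) = G x v" unfolding P(2) H_def by simp
    then show ?thesis unfolding G_def choi_def using has_sum_infsum[OF sm, of u y v x] by simp
  qed
  show thesis
  proof
    show "(\<Sum>k<n. (cmod (cinner (A k u) y))\<^sup>2) \<le> Re (cinner (\<mu> (rank_one u u) y) y)" for n u y
      using cholesky_square_sum_le[OF psd, of z "(u, y)" n] unfolding A(2) by (simp add: choi_def)
  qed (use A hs in blast)+
qed

text \<open>Summing \<open>le\<close> over an orthonormal basis of vectors \<open>y\<close> turns
  its left side into the sum of the \<open>(norm (A k u))^2\<close>, by Parseval, and its right side
  into the trace of \<open>\<mu> (rank_one u u)\<close>.\<close>

lemma kraus_sum_norm_le_of_trace:
  fixes \<mu> :: "('k::complex_hilbert \<Rightarrow> 'k) \<Rightarrow> ('h::complex_hilbert \<Rightarrow> 'h)"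
  assumes sub: "quantum_subchannel \<mu>" and A: "\<And>k::nat. bounded_clinear (A k)"
    and le: "\<And>n u y. (\<Sum>k<n. (cmod (cinner (A k u) y))\<^sup>2) \<le> Re (cinner (\<mu> (rank_one u u) y) y)"
  shows "(\<Sum>k<n. (norm (A k u))\<^sup>2) \<le> (norm u)\<^sup>2"
proof -
  have cp: "completely_positive \<mu>" using sub by (simp add: quantum_subchannel_def)
  then have \<mu>: "trace_class_bounded_clinear \<mu>" by (simp add: completely_positive_def)
  obtain B :: "'h set" where B: "is_onb B" using onb_exists by blast
  have unit: "(\<Sum>k<n. (norm (A k u))\<^sup>2) \<le> 1" if u: "norm u = 1" for u
  proof -
    have "density_op (rank_one u u)"
      by (simp add: density_op_def trace_class_rank_one positive_rank_one trace_rank_one u)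
    then have "trace (\<mu> (rank_one u u)) \<le> trace (rank_one u u)"
      using sub unfolding quantum_subchannel_def by blast
    then have tr: "Re (trace (\<mu> (rank_one u u))) \<le> 1"
      by (simp add: trace_rank_one u less_eq_complex_def)
    have "(\<Sum>k<n. (norm (A k u))\<^sup>2) \<le> Re (trace (\<mu> (rank_one u u)))"
    proof (rule has_sum_mono)
      show "((\<lambda>e. \<Sum>k<n. (cmod (cinner (A k u) e))\<^sup>2) has_sum (\<Sum>k<n. (norm (A k u))\<^sup>2)) B"
        by (rule has_sum_sum) (rule parseval_norm[OF B])
      show "((\<lambda>e. Re (cinner (\<mu> (rank_one u u) e) e)) has_sum Re (trace (\<mu> (rank_one u u)))) B"
        by (intro trace_positive_has_sum B trace_class_map[OF \<mu>] trace_class_rank_one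
            completely_positive_positive_op[OF cp] positive_rank_one)
    qed (rule le)
    with tr show ?thesis by simp
  qed
  show ?thesis
  proof (cases "u = 0")
    case True
    then show ?thesis by (simp add: bounded_clinearD(4)[OF A])
  next
    case False
    \<comment> \<open>The trace condition is assumed for density operators, so the estimate is
      available for unit vectors and is carried over by homogeneity.\<close>
    define w where "w = (1 / norm u) *\<^sub>R u"
    have "norm w = 1" and w: "u = norm u *\<^sub>R w" using False by (simp_all add: w_def)
    have "(\<Sum>k<n. (norm (A k u))\<^sup>2) = (norm u)\<^sup>2 * (\<Sum>k<n. (norm (A k w))\<^sup>2)"
      by (subst w) (simp add: bounded_clinearD(6)[OF A] power_mult_distrib sum_distrib_left)
    also have "\<dots> \<le> (norm u)\<^sup>2 * 1" by (intro mult_left_mono unit) (simp_all add: \<open>norm w = 1\<close>)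
    finally show ?thesis by simp
  qed
qed

text \<open>Cauchy-Schwarz in \<open>k\<close> bounds the form given by the sum of the
  \<open>cinner (A k x) (A k y)\<close> by \<open>norm x * norm y\<close>; so it is represented by a
  contraction \<open>S\<close>. The first two conclusions supply the majorant for the double sum in
  the Kraus formula.\<close>

lemma kraus_gram_sum:
  assumes A: "\<And>k::nat. bounded_clinear (A k :: 'k::complex_hilbert \<Rightarrow> 'h::complex_hilbert)"
    and le: "\<And>n u. (\<Sum>k<n. (norm (A k u))\<^sup>2) \<le> (norm u)\<^sup>2"
  shows "(\<lambda>k. norm (A k u) * norm (A k v)) summable_on UNIV"
    and "infsum (\<lambda>k. norm (A k u) * norm (A k v)) UNIV \<le> norm u * norm v"
    and "\<exists>S. wot_sums (\<lambda>k. adj (A k) \<circ> A k) S \<and> op_le S id"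
proof -
  have sq: "(\<Sum>k\<in>F. (norm (A k u))\<^sup>2) \<le> (norm u)\<^sup>2" if "finite F" for F u
  proof -
    obtain n where n: "F \<subseteq> {..<n}" using \<open>finite F\<close> finite_nat_iff_bounded by blast
    then have "(\<Sum>k\<in>F. (norm (A k u))\<^sup>2) \<le> (\<Sum>k<n. (norm (A k u))\<^sup>2)"
      by (intro sum_mono2) auto
    with le[of u n] show ?thesis by simp
  qed
  have s: "(\<lambda>k. norm (A k u) * norm (A k v)) summable_on UNIV"
    and i: "infsum (\<lambda>k. norm (A k u) * norm (A k v)) UNIV \<le> norm u * norm v" for u v
    using l2_product[of "norm u" "norm v" UNIV "\<lambda>k. norm (A k u)" "\<lambda>k. norm (A k v)"] sq by simp_all
  show "(\<lambda>k. norm (A k u) * norm (A k v)) summable_on UNIV"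
    and "infsum (\<lambda>k. norm (A k u) * norm (A k v)) UNIV \<le> norm u * norm v" by (rule s i)+
  have abs: "(\<lambda>k. cmod (cinner (A k x) (A k y))) summable_on UNIV" for x y
    by (rule summable_on_comparison_test[OF s[of x y]]) (auto simp: cmod_cinner_le)
  note sm = abs_summable_summable[OF abs]
  define f where "f x y = infsum (\<lambda>k. cinner (A k x) (A k y)) UNIV" for x y
  have fb: "cmod (f x y) \<le> 1 * norm x * norm y" for x y
  proof -
    have "cmod (f x y) \<le> infsum (\<lambda>k. norm (A k x) * norm (A k y)) UNIV"
      unfolding f_def
      by (rule norm_infsum_le[OF has_sum_infsum[OF sm] has_sum_infsum[OF s]]) (rule cmod_cinner_le)
    then show ?thesis using i[of x y] by simp
  qed
  obtain S where S: "bounded_clinear S" "\<And>x y. cinner (S x) y = f x y" "\<And>x. norm (S x) \<le> 1 * norm x"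
  proof (rule bounded_form_represented[of f, OF _ _ _ _ fb])
    show "f (x + x') y = f x y + f x' y" "f x (y + y') = f x y + f x y'" for x x' y y'
      unfolding f_def by (simp_all add: bounded_clinearD(2)[OF A] cinner_add_left cinner_add_right infsum_add sm)
    show "f (c *\<^sub>C x) y = c * f x y" "f x (c *\<^sub>C y) = cnj c * f x y" for c x y
      unfolding f_def
      by (simp_all add: bounded_clinearD(3)[OF A] cinner_scaleC_left cinner_scaleC_right infsum_cmult_right')
  qed auto
  have sym: "cinner (S x) y = cinner x (S y)" for x y
  proof -
    have "cinner x (S y) = cnj (f y x)" by (metis S(2) cinner_commute)
    also have "\<dots> = f x y"
      unfolding f_def by (simp flip: cinner_commute infsum_cnj)
    finally show ?thesis by (simp add: S(2))
  qed
  have "positive_op (\<lambda>x. id x - S x)"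
  proof (rule positive_opI)
    show "bounded_clinear (\<lambda>x. id x - S x)"
      using bounded_clinear_diff[OF bounded_clinear_id S(1)] by simp
    show "cinner (id x - S x) y = cinner x (id y - S y)" for x y
      by (simp add: cinner_diff_left cinner_diff_right sym)
    \<comment> \<open>The constant \<open>1\<close> in \<open>fb\<close> is what gives
      \<open>S \<le> id\<close>.\<close>
    show "0 \<le> Re (cinner (id x - S x) x)" for x
      using complex_Re_le_cmod[of "f x x"] fb[of x x]
      by (simp add: cinner_diff_left cinner_self S(2) power2_eq_square)
  qed
  moreover have "selfadjoint S"
    unfolding selfadjoint_def by (intro conjI S(1) adj_eqI sym)
  moreover have "selfadjoint (id :: 'k \<Rightarrow> 'k)"
    unfolding selfadjoint_def using bounded_clinear_id by (auto simp: id_def intro: adj_eqI)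
  ultimately have "op_le S id" by (simp add: op_le_def)
  moreover have "wot_sums (\<lambda>k. adj (A k) \<circ> A k) S"
    unfolding wot_sums_def using S(1) has_sum_imp_sums[OF has_sum_infsum[OF sm]]
    by (simp add: cinner_adj'[OF A] S(2) f_def)
  ultimately show "\<exists>S. wot_sums (\<lambda>k. adj (A k) \<circ> A k) S \<and> op_le S id" by blast
qed

text \<open>Insert a nuclear series for \<open>a\<close> and sum over pairs \<open>(i, k)\<close> in
  both orders: \<open>k\<close> first gives the rank one formula and then \<open>\<mu> a\<close>,
  \<open>i\<close> first gives the matrix elements of
  \<open>A k \<circ> a \<circ> adj (A k)\<close>.\<close>

lemma kraus_representation:
  fixes \<mu> :: "('k::complex_hilbert \<Rightarrow> 'k) \<Rightarrow> ('h::complex_hilbert \<Rightarrow> 'h)"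
  assumes \<mu>: "trace_class_bounded_clinear \<mu>" and A: "\<And>k::nat. bounded_clinear (A k)"
    and r1: "\<And>u v x y. ((\<lambda>k. cinner (A k u) y * cnj (cinner (A k v) x)) has_sum cinner (\<mu> (rank_one u v) x) y) UNIV"
    and le: "\<And>n u. (\<Sum>k<n. (norm (A k u))\<^sup>2) \<le> (norm u)\<^sup>2"
    and a: "trace_class a"
  shows "wot_sums (\<lambda>k. A k \<circ> a \<circ> adj (A k)) (\<mu> a)"
  unfolding wot_sums_def
proof (intro conjI allI)
  show "bounded_clinear (\<mu> a)" by (rule trace_class_clinear[OF trace_class_map[OF \<mu> a]])
  fix x y
  obtain I :: "'k set" and u v where r: "nuclear_series I u v a"
    by (rule trace_class_nuclear_series[OF a])
  define f where "f = (\<lambda>(i, k). cinner (A k (u i)) y * cnj (cinner (A k (v i)) x))"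
  define b where "b = (\<lambda>(i, k). norm (A k (u i)) * norm (A k (v i)) * (norm x * norm y))"
  \<comment> \<open>Summing over \<open>k\<close> leaves at most
    \<open>norm (u i) * norm (v i) * (norm x * norm y)\<close>, which is summable over
    \<open>i\<close>.\<close>
  have bs: "b summable_on I \<times> UNIV"
  proof (rule summable_on_SigmaI)
    show "((\<lambda>k. b (i, k)) has_sum infsum (\<lambda>k. norm (A k (u i)) * norm (A k (v i))) UNIV * (norm x * norm y)) UNIV" for i
      unfolding b_def prod.case
      by (intro has_sum_cmult_left has_sum_infsum kraus_gram_sum(1)[OF A le])
    show "(\<lambda>i. infsum (\<lambda>k. norm (A k (u i)) * norm (A k (v i))) UNIV * (norm x * norm y)) summable_on I"
    proof (rule summable_on_cmult_left, rule summable_on_comparison_test)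
      show "(\<lambda>i. norm (u i) * norm (v i)) summable_on I" using r by (simp add: nuclear_series_def)
      show "infsum (\<lambda>k. norm (A k (u i)) * norm (A k (v i))) UNIV \<le> norm (u i) * norm (v i)" for i
        by (rule kraus_gram_sum(2)[OF A le])
    qed (auto intro: infsum_nonneg)
  qed (auto simp: b_def)
  have fb: "cmod (f p) \<le> b p" for p
  proof (cases p)
    case (Pair i k)
    have "cmod (cinner (A k (u i)) y) * cmod (cinner (A k (v i)) x)
      \<le> (norm (A k (u i)) * norm y) * (norm (A k (v i)) * norm x)"
      by (intro mult_mono cmod_cinner_le) auto
    then show ?thesis by (simp add: Pair f_def b_def norm_mult mult_ac)
  qed
  have "(\<lambda>p. cmod (f p)) summable_on I \<times> UNIV"
    by (rule summable_on_comparison_test[OF bs fb]) simp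
  then have "f summable_on I \<times> UNIV" by (rule abs_summable_summable)
  \<comment> \<open>For each \<open>i\<close> the inner sum over \<open>k\<close> is the rank one
    case \<open>r1\<close>; the outer sum is the nuclear series mapped by \<mu>.\<close>
  then have "(f has_sum cinner (\<mu> a x) y) (I \<times> UNIV)"
    by (rule has_sum_SigmaI[OF _ map_nuclear_series_has_sum[OF \<mu> a r], rotated]) (simp add: f_def r1)
  then have "((\<lambda>(k, i). f (i, k)) has_sum cinner (\<mu> a x) y) (UNIV \<times> I)"
    by (rule has_sum_swap[THEN iffD1])
  \<comment> \<open>Now \<open>i\<close> is summed first: the series of \<open>a\<close> is tested
    on the vectors \<open>adj (A k) x\<close> and \<open>adj (A k) y\<close>.\<close>
  then have "((\<lambda>k. cinner ((A k \<circ> a \<circ> adj (A k)) x) y) has_sum cinner (\<mu> a x) y) UNIV"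
  proof (rule has_sum_SigmaD)
    fix k
    have "((\<lambda>i. cinner (adj (A k) x) (v i) * cinner (u i) (adj (A k) y)) has_sum
      cinner (a (adj (A k) x)) (adj (A k) y)) I"
      using r unfolding nuclear_series_def by blast
    moreover have "cinner (adj (A k) x) (v i) * cinner (u i) (adj (A k) y) = f (i, k)" for i
      unfolding f_def by (simp add: cinner_adj'[OF A] mult.commute flip: cinner_adj[OF A] cinner_commute)
    ultimately show "((\<lambda>i. case (k, i) of (k, i) \<Rightarrow> f (i, k)) has_sum cinner ((A k \<circ> a \<circ> adj (A k)) x) y) I"
      by (simp add: cinner_adj[OF A])
  qed
  then show "(\<lambda>k. cinner ((A k \<circ> a \<circ> adj (A k)) x) y) sums cinner (\<mu> a x) y"
    by (rule has_sum_imp_sums)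
qed

theorem theorem9:
  fixes \<mu> :: "('k::complex_hilbert \<Rightarrow> 'k) \<Rightarrow> ('h::complex_hilbert \<Rightarrow> 'h)"
  assumes "separable_space (euclidean :: 'k topology)"
    and "separable_space (euclidean :: 'h topology)"
    and "trace_class_bounded_clinear \<mu>"
  shows "quantum_subchannel \<mu> \<longleftrightarrow>
    (\<exists>A :: nat \<Rightarrow> 'k \<Rightarrow> 'h.
      (\<forall>i. bounded_clinear (A i)) \<and>
      (\<forall>a. trace_class a \<longrightarrow> wot_sums (\<lambda>i. A i \<circ> a \<circ> adj (A i)) (\<mu> a)) \<and>
      (\<exists>S. wot_sums (\<lambda>i. adj (A i) \<circ> A i) S \<and> op_le S id))"
proof
  assume sub: "quantum_subchannel \<mu>"
  then have cp: "completely_positive \<mu>" by (simp add: quantum_subchannel_def)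
  obtain A where A: "\<And>k::nat. bounded_clinear (A k)"
    "\<And>u v x y. ((\<lambda>k. cinner (A k u) y * cnj (cinner (A k v) x)) has_sum cinner (\<mu> (rank_one u v) x) y) UNIV"
    "\<And>n u y. (\<Sum>k<n. (cmod (cinner (A k u) y))\<^sup>2) \<le> Re (cinner (\<mu> (rank_one u u) y) y)"
    using kraus_operators_rank_one[OF assms(1,2) cp] by blast
  note le = kraus_sum_norm_le_of_trace[OF sub A(1,3)]
  show "\<exists>A :: nat \<Rightarrow> 'k \<Rightarrow> 'h.
      (\<forall>i. bounded_clinear (A i)) \<and>
      (\<forall>a. trace_class a \<longrightarrow> wot_sums (\<lambda>i. A i \<circ> a \<circ> adj (A i)) (\<mu> a)) \<and>
      (\<exists>S. wot_sums (\<lambda>i. adj (A i) \<circ> A i) S \<and> op_le S id)"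
    using A(1) kraus_representation[OF assms(3) A(1,2) le] kraus_gram_sum(3)[OF A(1) le] by blast
next
  assume "\<exists>A :: nat \<Rightarrow> 'k \<Rightarrow> 'h.
      (\<forall>i. bounded_clinear (A i)) \<and>
      (\<forall>a. trace_class a \<longrightarrow> wot_sums (\<lambda>i. A i \<circ> a \<circ> adj (A i)) (\<mu> a)) \<and>
      (\<exists>S. wot_sums (\<lambda>i. adj (A i) \<circ> A i) S \<and> op_le S id)"
  then show "quantum_subchannel \<mu>" using kraus_imp_subchannel[OF assms(3)] by blast
qed

end
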